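(* Let $\mathbb{F}_q$ be a finite field with $q$ elements, let $A=\mathbb{F}_q[X]$ and $\widehat K=\mathbb{F}_q((X^{-1}))$. Let $\Gamma$ be a finite index subgroup of $\mathrm{SL}_2(A)$. Let $\varphi:\mathbb{R}_+\to\mathbb{R}_+$ be a map such that $u\mapsto\varphi(e^u)$ is slowly varying. If the integral $\int_1^{+\infty}\varphi(t)/t\;dt$ diverges (respectively converges), then for almost every (respectively almost no) $f$ in $\widehat K$, there exist infinitely many couples $(P,Q)$ in $A\times(A-\{0\})$, where $P$ is coprime with $Q$ and $P/Q\in\Gamma\infty$, such that $$\left|f-\frac{P}{Q}\right|_\infty\leq\frac{\varphi(|Q|_\infty)}{|Q|_\infty^2}.$$
   Context: $\widehat K=\mathbb{F}_q((X^{-1}))$ is the field of formal Laurent series in $X^{-1}$ over $\mathbb{F}_q$. For $f\in\widehat K-\{0\}$, written $f=\sum_{i=n}^\infty a_iX^{-i}$ with $a_n\neq0$, $n\in\mathbb{Z}$, set $|f|_\infty=q^{-n}$; and $|0|_\infty=0$. "Almost every" and "almost no" are with respect to the Haar measure of the locally compact additive group $\widehat K$ ("for almost no $f$" means that the set of such $f$ has measure zero). The group $\mathrm{SL}_2(\widehat K)$ acts by homographies on the projective line $\widehat K\cup\{\infty\}$, and $\Gamma\infty$ is the orbit of the point $\infty$ under $\Gamma$; $\Gamma\infty-\{\infty\}$ is contained in $\mathbb{F}_q(X)$. A map $\psi:\mathbb{R}_+\to\mathbb{R}_+$ is slowly varying if it is measurable and there exist constants $B>0$ and $a\geq1$ such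 that for all $x,y\in\mathbb{R}_+$, if $|x-y|\leq B$ then $\psi(y)\leq a\,\psi(x)$. *)

theory Defs
  imports
    "HOL-Analysis.Analysis"
    "HOL-Computational_Algebra.Formal_Laurent_Series"
    "HOL-Algebra.Group_Action"
begin

text \<open>
  The type \<open>'a fls\<close> consists of the formal Laurent series in one variable
  \<^const>\<open>fls_X\<close>. Here \<open>'a\<close> is the field with q = \<open>CARD('a)\<close> elements, and
  \<^const>\<open>fls_X\<close> plays the role of the inverse of the indeterminate X of the polynomial ring
  \<open>'a poly\<close>; so X itself is \<^const>\<open>fls_X_inv\<close>, and a Laurent series in the inverse of X with
  leading term of index n has \<^const>\<open>fls_subdegree\<close> equal to n.
\<close>

definition poly_to_fls_inv :: "'a::comm_ring_1 poly \<Rightarrow> 'a fls" where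
  "poly_to_fls_inv P = poly (map_poly fls_const P) fls_X_inv"

definition abs_infty :: "'a::{zero,finite} fls \<Rightarrow> real" where
  "abs_infty f = (if f = 0 then 0 else real CARD('a) powi (- fls_subdegree f))"

text \<open>
  The library's metric on \<open>'a fls\<close> uses powers of 2 instead of powers of q. It induces the same
  topology as \<open>abs_infty\<close>, hence the same Borel sets and the same compact sets.
\<close>

lemma card_field_gt_1: "CARD('a::{field,finite}) > 1"
proof -
  have "card {0, 1 :: 'a} \<le> CARD('a)"
    by (rule card_mono) auto
  then show ?thesis by simp
qed

lemma dist_fls_powi:
  "dist (f :: 'a::group_add fls) g = (if f = g then 0 else 2 powi (- fls_subdegree (f - g)))"
  by (simp add: dist_fls_def power_int_def field_simps)

lemma abs_infty_less_iff:
  fixes h :: "'a::{field,finite} fls"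
  shows "abs_infty h < real CARD('a) powi (- n) \<longleftrightarrow> dist h 0 < 2 powi (- n)"
proof -
  have q: "1 < real CARD('a)"
    using card_field_gt_1[where 'a='a] by simp
  then have "0 < real CARD('a) powi (- n)"
    by (intro zero_less_power_int) linarith
  moreover have "b powi i < b powi j \<longleftrightarrow> i < j" if "b > 1" for b :: real and i j
    using that power_int_strict_increasing[of i j b] power_int_increasing[of j i b]
    by (meson less_imp_le not_less)
  ultimately show ?thesis
    using q by (simp add: abs_infty_def dist_fls_powi)
qed

lemma open_fls_iff_abs_infty:
  fixes S :: "'a::{field,finite} fls set"
  shows "open S \<longleftrightarrow> (\<forall>f\<in>S. \<exists>r>0. {g. abs_infty (g - f) < r} \<subseteq> S)"
proof -
  have small: "\<exists>n. b powi (- n) < r" and pos: "b powi n > 0"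
    if "b > 1" "r > 0" for b r :: real and n :: int
  proof -
    have "1 / b < 1"
      using \<open>b > 1\<close> by simp
    from real_arch_pow_inv[OF \<open>r > 0\<close> this] obtain m where "(1 / b) ^ m < r" ..
    then have "b powi (- int m) < r"
      by (simp add: power_int_minus power_divide inverse_eq_divide)
    then show "\<exists>n. b powi (- n) < r" ..
    show "b powi n > 0"
      using that by simp
  qed
  have q: "1 < real CARD('a)"
    using card_field_gt_1[where 'a='a] by simp
  have less_iff: "abs_infty (g - f) < real CARD('a) powi (- n) \<longleftrightarrow> dist g f < 2 powi (- n)"
    for f g :: "'a fls" and n
    using abs_infty_less_iff[of "g - f" n] by (simp add: dist_fls_powi)
  have "(\<exists>r>0. {g. dist g f < r} \<subseteq> S) \<longleftrightarrow> (\<exists>r>0. {g. abs_infty (g - f) < r} \<subseteq> S)" for f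
  proof
    assume "\<exists>r>0. {g. dist g f < r} \<subseteq> S"
    then obtain r where r: "r > 0" "{g. dist g f < r} \<subseteq> S" by blast
    obtain n where n: "2 powi (- n) < r" using small[of 2 r] r by auto
    have "{g. abs_infty (g - f) < real CARD('a) powi (- n)} \<subseteq> S"
      unfolding less_iff using r n by force
    then show "\<exists>r>0. {g. abs_infty (g - f) < r} \<subseteq> S"
      using pos[OF q zero_less_one] by blast
  next
    assume "\<exists>r>0. {g. abs_infty (g - f) < r} \<subseteq> S"
    then obtain r where r: "r > 0" "{g. abs_infty (g - f) < r} \<subseteq> S" by blast
    obtain n where n: "real CARD('a) powi (- n) < r" using small[OF q] r by auto
    have "{g. dist g f < 2 powi (- n)} \<subseteq> S"
      unfolding less_iff[symmetric] using r n by force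
    then show "\<exists>r>0. {g. dist g f < r} \<subseteq> S"
      by (intro exI[of _ "2 powi (- n)"]) simp
  qed
  then show ?thesis
    by (simp add: open_fls_def)
qed

text \<open>
  Regularity is not required below: the groups \<open>'a fls\<close> to which the definition is applied are
  locally compact and second countable, so it is automatic.
\<close>

definition haar_measure :: "'g::{topological_space,ab_group_add} measure \<Rightarrow> bool" where
  "haar_measure \<mu> \<longleftrightarrow>
     sets \<mu> = sets borel \<and>
     (\<forall>S\<in>sets borel. \<forall>g. emeasure \<mu> ((\<lambda>x. g + x) ` S) = emeasure \<mu> S) \<and>
     (\<forall>C. compact C \<longrightarrow> C \<in> sets borel \<longrightarrow> emeasure \<mu> C < \<infinity>) \<and>
     (\<forall>U. open U \<longrightarrow> U \<noteq> {} \<longrightarrow> emeasure \<mu> U > 0)"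

definition SL2 :: "('r::comm_ring_1 ^ 2 ^ 2) monoid" where
  "SL2 = \<lparr>carrier = {g. det g = 1}, monoid.mult = (**), one = mat 1\<rparr>"

lemma group_SL2: "group (SL2 :: ('r::comm_ring_1 ^ 2 ^ 2) monoid)"
proof (rule groupI)
  fix g :: "'r ^ 2 ^ 2"
  assume "g \<in> carrier SL2"
  then have g: "g $ 1 $ 1 * g $ 2 $ 2 - g $ 1 $ 2 * g $ 2 $ 1 = 1"
    by (simp add: SL2_def det_2)
  define h :: "'r ^ 2 ^ 2" where
    "h = vector [vector [g $ 2 $ 2, - g $ 1 $ 2], vector [- g $ 2 $ 1, g $ 1 $ 1]]"
  have "det h = 1"
    using g by (simp add: det_2 h_def mult.commute)
  moreover have "h ** g = mat 1"
    using g by (simp add: h_def vec_eq_iff forall_2 matrix_matrix_mult_def sum_2 mat_def algebra_simps)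
  ultimately show "\<exists>h\<in>carrier SL2. h \<otimes>\<^bsub>SL2\<^esub> g = \<one>\<^bsub>SL2\<^esub>"
    by (auto simp: SL2_def)
qed (simp_all add: SL2_def det_mul matrix_mul_assoc)

datatype 'k proj_line = Fin 'k | Infty

fun homography :: "'k::field ^ 2 ^ 2 \<Rightarrow> 'k proj_line \<Rightarrow> 'k proj_line" where
  "homography g (Fin z) =
     (let n = g $ 1 $ 1 * z + g $ 1 $ 2; d = g $ 2 $ 1 * z + g $ 2 $ 2
      in if d = 0 then Infty else Fin (n / d))"
| "homography g Infty =
     (if g $ 2 $ 1 = 0 then Infty else Fin (g $ 1 $ 1 / g $ 2 $ 1))"

definition orbit_infty :: "('a::field poly ^ 2 ^ 2) set \<Rightarrow> 'a fls proj_line set" where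
  "orbit_infty \<Gamma> =
     orbit (SL2\<lparr>carrier := \<Gamma>\<rparr>) (\<lambda>g. homography (map_matrix poly_to_fls_inv g)) Infty"

text \<open>
  Only the values of \<open>\<psi>\<close> on the nonnegative reals matter. Lebesgue measurability is the weakest
  usual reading of ``measurable''; it covers Borel measurable functions.
\<close>

definition slowly_varying :: "(real \<Rightarrow> real) \<Rightarrow> bool" where
  "slowly_varying \<psi> \<longleftrightarrow>
     \<psi> \<in> borel_measurable (lebesgue_on {0..}) \<and>
     (\<exists>B>0. \<exists>a\<ge>1. \<forall>x\<ge>0. \<forall>y\<ge>0. \<bar>x - y\<bar> \<le> B \<longrightarrow> \<psi> y \<le> a * \<psi> x)"

definition approximants ::
  "('a::{field,finite} poly ^ 2 ^ 2) set \<Rightarrow> (real \<Rightarrow> real) \<Rightarrow> 'a fls \<Rightarrow> ('a poly \<times> 'a poly) set"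
where
  "approximants \<Gamma> \<phi> f =
     {(P, Q). Q \<noteq> 0 \<and> coprime P Q \<and>
        Fin (poly_to_fls_inv P / poly_to_fls_inv Q) \<in> orbit_infty \<Gamma> \<and>
        abs_infty (f - poly_to_fls_inv P / poly_to_fls_inv Q)
          \<le> \<phi> (abs_infty (poly_to_fls_inv Q)) / (abs_infty (poly_to_fls_inv Q))\<^sup>2}"

end

theory Submission
  imports Defs
begin

text \<open>
  Balls have measure proportional to their radius, and two distinct fractions whose denominators
  have degrees \<open>m\<close> and \<open>n\<close> are at distance at least \<open>q\<^sup>-\<^sup>m\<^sup>-\<^sup>n\<close>. Packing disjoint balls around the
  fractions therefore bounds their number in any ball, which gives the convergence case by the
  Borel--Cantelli lemma, and also bounds the overlap of the approximation sets of two different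
  degrees by a constant times the product of their measures.

  For divergence, Dirichlet's theorem shows that outside a set of measure at most half of a given
  ball every point lies within \<open>q\<^sup>-\<^sup>2\<^sup>m\<close> of a fraction \<open>P / Q\<close> with \<open>deg Q = m\<close> in a window of bounded
  length. Writing \<open>P / Q\<close> as \<open>g \<infinity>\<close> and multiplying \<open>g\<close> on the right by one of finitely many
  matrices, chosen according to the coset \<open>\<Gamma> g\<close>, gives a point of \<open>\<Gamma> \<infinity>\<close> nearby, so \<open>\<Gamma> \<infinity>\<close> has a
  positive proportion of the fractions with denominators in some degree of every such window.
  With the bound on overlaps, the approximation sets of degree at least \<open>M\<close> cover a fixed proportion
  \<open>\<delta>\<close> of every ball, for every \<open>M\<close>. The points that they miss form a decreasing limit of finite
  unions of balls, hence a null set.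
\<close>

no_notation fps_nth (infixl "$" 75)
notation fls_nth (infixl "$$" 75)

section \<open>Polynomials as Laurent series\<close>

lemma poly_to_fls_inv_0 [simp]: "poly_to_fls_inv 0 = 0"
  by (simp add: poly_to_fls_inv_def)

lemma poly_to_fls_inv_pCons:
  "poly_to_fls_inv (pCons a P) = fls_const a + fls_X_inv * poly_to_fls_inv P"
  by (simp add: poly_to_fls_inv_def map_poly_pCons)

text \<open>Horner's recursion lowers the index by one per factor \<open>X\<close>. Additivity,
  injectivity and the subdegree of the embedding are read off from these coefficients.\<close>

lemma poly_to_fls_inv_nth:
  "poly_to_fls_inv P $$ k = (if k \<le> 0 then coeff P (nat (- k)) else 0)"
proof (induction P arbitrary: k)
  case (pCons a P)
  show ?case
    by (auto simp: poly_to_fls_inv_pCons fls_X_inv_times_conv_shift pCons.IH coeff_pCons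
        split: nat.splits) (auto simp: nat_eq_iff intro!: arg_cong[of _ _ "coeff P"])
qed simp

lemma poly_to_fls_inv_add: "poly_to_fls_inv (P + Q) = poly_to_fls_inv P + poly_to_fls_inv Q"
  by (intro fls_eqI) (simp add: poly_to_fls_inv_nth)

lemma poly_to_fls_inv_diff: "poly_to_fls_inv (P - Q) = poly_to_fls_inv P - poly_to_fls_inv Q"
  by (intro fls_eqI) (simp add: poly_to_fls_inv_nth)

lemma poly_to_fls_inv_smult: "poly_to_fls_inv (smult a P) = fls_const a * poly_to_fls_inv P"
  by (intro fls_eqI) (simp add: poly_to_fls_inv_nth)

lemma poly_to_fls_inv_mult: "poly_to_fls_inv (P * Q) = poly_to_fls_inv P * poly_to_fls_inv Q"
  by (induction P)
    (simp_all add: mult_pCons_left poly_to_fls_inv_add poly_to_fls_inv_smult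
      poly_to_fls_inv_pCons algebra_simps)

lemma poly_to_fls_inv_eq_iff: "poly_to_fls_inv P = poly_to_fls_inv Q \<longleftrightarrow> P = Q"
proof
  assume "poly_to_fls_inv P = poly_to_fls_inv Q"
  then have "poly_to_fls_inv P $$ (- int k) = poly_to_fls_inv Q $$ (- int k)" for k
    by simp
  then show "P = Q"
    by (intro poly_eqI) (simp add: poly_to_fls_inv_nth)
qed simp

lemma poly_to_fls_inv_eq_0_iff [simp]: "poly_to_fls_inv P = 0 \<longleftrightarrow> P = 0"
  using poly_to_fls_inv_eq_iff[of P 0] by simp

lemma fls_subdegree_poly_to_fls_inv [simp]:
  "fls_subdegree (poly_to_fls_inv P) = - int (degree P)"
proof (cases "P = 0")
  case False
  then show ?thesis
    by (intro fls_subdegree_eqI) (auto simp: poly_to_fls_inv_nth intro!: coeff_eq_0)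
qed simp

lemma coeff_sum_monom: "coeff (\<Sum>i\<le>n. monom (c i) i) k = (if k \<le> n then c k else 0)"
  by (simp add: coeff_sum if_distrib cong: if_cong)

text \<open>Only finitely many coefficients of nonpositive index are nonzero, so they form a
  polynomial, the integral part of \<open>f\<close>.\<close>

lemma fls_poly_part: "\<exists>P. \<forall>i\<le>0. poly_to_fls_inv P $$ i = f $$ i"
proof -
  define d where "d = nat (- fls_subdegree f)"
  have "poly_to_fls_inv (\<Sum>i\<le>d. monom (f $$ (- int i)) i) $$ i = f $$ i" if "i \<le> 0" for i
    using that by (simp add: poly_to_fls_inv_nth coeff_sum_monom d_def)
  then show ?thesis by blast
qed

section \<open>Balls\<close>

text \<open>The ball of radius \<open>q\<^sup>-\<^sup>r\<close>, closed for \<open>abs_infty\<close>.\<close>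

definition fls_cball :: "'a::zero fls \<Rightarrow> int \<Rightarrow> 'a fls set" where
  "fls_cball x r = {f. \<forall>i<r. f $$ i = x $$ i}"

lemma centre_in_fls_cball [simp]: "x \<in> fls_cball x r"
  by (simp add: fls_cball_def)

lemma fls_cball_commute: "y \<in> fls_cball x r \<longleftrightarrow> x \<in> fls_cball y r"
  by (auto simp: fls_cball_def)

lemma fls_cball_mono: "r \<le> s \<Longrightarrow> fls_cball x s \<subseteq> fls_cball x r"
  by (auto simp: fls_cball_def)

text \<open>Agreement below index \<open>r\<close> is an equivalence relation whose classes are the
  balls of level \<open>r\<close>, so every point of a ball is a centre and two balls of one level
  are equal or disjoint.\<close>

lemma fls_cball_eq: "y \<in> fls_cball x r \<Longrightarrow> fls_cball y r = fls_cball x r"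
  by (auto simp: fls_cball_def)

lemma fls_cball_subset: "y \<in> fls_cball x r \<Longrightarrow> r \<le> s \<Longrightarrow> fls_cball y s \<subseteq> fls_cball x r"
  using fls_cball_eq fls_cball_mono by metis

lemma fls_cball_trans:
  "y \<in> fls_cball x r \<Longrightarrow> z \<in> fls_cball y s \<Longrightarrow> t \<le> r \<Longrightarrow> t \<le> s \<Longrightarrow> z \<in> fls_cball x t"
  by (auto simp: fls_cball_def)

text \<open>The case \<open>f = x\<close> stands apart because \<open>fls_subdegree 0\<close> is 0
  by convention instead of infinite.\<close>

lemma mem_fls_cball_iff:
  fixes x :: "'a::group_add fls"
  shows "f \<in> fls_cball x r \<longleftrightarrow> f = x \<or> r \<le> fls_subdegree (f - x)"
proof
  assume *: "f \<in> fls_cball x r"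
  show "f = x \<or> r \<le> fls_subdegree (f - x)"
  proof (cases "f = x")
    case False
    with * show ?thesis
      by (intro disjI2 fls_subdegree_geI) (auto simp: fls_cball_def)
  qed simp
next
  assume "f = x \<or> r \<le> fls_subdegree (f - x)"
  moreover have "f $$ i = x $$ i" if "r \<le> fls_subdegree (f - x)" "i < r" for i
    using fls_eq0_below_subdegree[of i "f - x"] that by simp
  ultimately show "f \<in> fls_cball x r"
    by (auto simp: fls_cball_def)
qed

lemma power_int_le_iff:
  fixes b :: real
  assumes "b > 1"
  shows "b powi i \<le> b powi j \<longleftrightarrow> i \<le> j"
  using power_int_increasing[of i j b] power_int_strict_increasing[of j i b] assms
  by (meson less_imp_le not_less)

lemma mem_fls_cball_iff_abs_infty:
  fixes x :: "'a::{field,finite} fls"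
  shows "f \<in> fls_cball x r \<longleftrightarrow> abs_infty (f - x) \<le> real CARD('a) powi (- r)"
proof -
  have q: "1 < real CARD('a)"
    using card_field_gt_1[where 'a='a] by simp
  then show ?thesis
    by (auto simp: abs_infty_def mem_fls_cball_iff power_int_le_iff)
qed

lemma fls_cball_translate:
  fixes x :: "'a::ab_group_add fls"
  shows "(\<lambda>f. g + f) ` fls_cball x r = fls_cball (g + x) r"
proof
  show "fls_cball (g + x) r \<subseteq> (\<lambda>f. g + f) ` fls_cball x r"
  proof
    fix f assume "f \<in> fls_cball (g + x) r"
    then show "f \<in> (\<lambda>f. g + f) ` fls_cball x r"
      by (intro image_eqI[of _ _ "f - g"]) (auto simp: fls_cball_def)
  qed
qed (auto simp: fls_cball_def)

text \<open>The points are sorted by their coefficient of index \<open>r\<close>, which gives one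
  subball per field element.\<close>

lemma fls_cball_split:
  fixes x :: "'a::comm_ring_1 fls"
  shows "fls_cball x r = (\<Union>a. fls_cball (x + fls_shift (- r) (fls_const a)) (r + 1))"
    and "disjoint_family (\<lambda>a. fls_cball (x + fls_shift (- r) (fls_const a)) (r + 1))"
proof -
  have *: "f \<in> fls_cball (x + fls_shift (- r) (fls_const a)) (r + 1) \<longleftrightarrow>
      f \<in> fls_cball x r \<and> a = f $$ r - x $$ r" for f a
    by (auto simp: fls_cball_def fls_shift_const_nth zless_add1_eq)
  show "fls_cball x r = (\<Union>a. fls_cball (x + fls_shift (- r) (fls_const a)) (r + 1))"
    using * by auto
  show "disjoint_family (\<lambda>a. fls_cball (x + fls_shift (- r) (fls_const a)) (r + 1))"
    using * by (auto simp: disjoint_family_on_def)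
qed

lemma fls_cball_partition:
  fixes x :: "'a::{comm_ring_1,finite} fls"
  shows "\<exists>Y. finite Y \<and> fls_cball x r = (\<Union>y\<in>Y. fls_cball y (r + int n)) \<and>
    disjoint_family_on (\<lambda>y. fls_cball y (r + int n)) Y"
proof (induction n)
  case 0
  show ?case
    by (rule exI[of _ "{x}"]) (simp add: disjoint_family_on_def)
next
  case (Suc n)
  then obtain Y where Y: "finite Y" "fls_cball x r = (\<Union>y\<in>Y. fls_cball y (r + int n))"
    "disjoint_family_on (\<lambda>y. fls_cball y (r + int n)) Y" by blast
  define s where "s = r + int n"
  define c where "c y a = y + fls_shift (- s) (fls_const a)" for y :: "'a fls" and a :: 'a
  have split: "fls_cball y s = (\<Union>a. fls_cball (c y a) (s + 1))"
    and disj: "disjoint_family (\<lambda>a. fls_cball (c y a) (s + 1))" for y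
    using fls_cball_split[of y s] by (simp_all add: c_def)
  define Z where "Z = (\<lambda>(y, a). c y a) ` (Y \<times> UNIV)"
  have "finite Z"
    using \<open>finite Y\<close> by (simp add: Z_def)
  moreover have "fls_cball x r = (\<Union>z\<in>Z. fls_cball z (s + 1))"
    using Y(2) split by (auto simp: Z_def s_def)
  moreover have "disjoint_family_on (\<lambda>z. fls_cball z (s + 1)) Z"
  proof (unfold disjoint_family_on_def, intro ballI impI)
    fix z z' assume "z \<in> Z" "z' \<in> Z" "z \<noteq> z'"
    then obtain y a y' a' where z: "z = c y a" "z' = c y' a'" "y \<in> Y" "y' \<in> Y"
      by (auto simp: Z_def)
    show "fls_cball z (s + 1) \<inter> fls_cball z' (s + 1) = {}"
    proof (cases "y = y'")
      case True
      with \<open>z \<noteq> z'\<close> z have "a \<noteq> a'" by auto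
      with disj[of y] True z show ?thesis by (auto simp: disjoint_family_on_def)
    next
      case False
      with Y(3) z have "fls_cball y s \<inter> fls_cball y' s = {}"
        by (auto simp: disjoint_family_on_def s_def)
      with split z show ?thesis by blast
    qed
  qed
  ultimately show ?case
    by (intro exI[of _ Z]) (simp add: s_def add_ac)
qed

lemma open_fls_cball: "open (fls_cball (x :: 'a::group_add fls) r)"
proof (unfold open_fls_def, intro ballI exI conjI)
  fix f assume f: "f \<in> fls_cball x r"
  show "{g. dist g f < 2 powi (- r)} \<subseteq> fls_cball x r"
  proof
    fix g assume "g \<in> {g. dist g f < 2 powi (- r)}"
    then have "g = f \<or> 2 powi (- fls_subdegree (g - f)) < (2::real) powi (- r)"
      by (auto simp: dist_fls_powi split: if_splits)
    then have "g \<in> fls_cball f r"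
      using power_int_increasing[of "- r" "- fls_subdegree (g - f)" "2::real"]
      by (auto simp: mem_fls_cball_iff not_less[symmetric])
    with f show "g \<in> fls_cball x r"
      using fls_cball_eq by metis
  qed
qed simp

lemma fls_cball_in_dist_ball:
  assumes "e > 0"
  shows "\<exists>n. \<forall>f. fls_cball (f :: 'a::group_add fls) (int n) \<subseteq> ball f e"
proof -
  obtain n where n: "(1 / 2) ^ n < e"
    using real_arch_pow_inv[OF assms, of "1/2"] by auto
  have "dist f g < e" if "g \<in> fls_cball f (int n)" for f g :: "'a fls"
  proof (cases "g = f")
    case False
    with that have "int n \<le> fls_subdegree (g - f)"
      by (simp add: mem_fls_cball_iff)
    then have "dist g f \<le> 2 powi (- int n)"
      using False by (auto simp: dist_fls_powi intro!: power_int_increasing)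
    also have "\<dots> = (1 / 2) ^ n"
      by (simp add: power_int_minus power_divide inverse_eq_divide)
    finally show ?thesis
      using n by (simp add: dist_commute)
  qed (use assms in simp)
  then have "\<forall>f. fls_cball (f :: 'a fls) (int n) \<subseteq> ball f e"
    by auto
  then show ?thesis ..
qed

text \<open>Completeness holds because a Cauchy sequence stabilises in each coefficient, total
  boundedness because the finite field lets a ball split into finitely many balls of any smaller
  radius.\<close>

lemma compact_fls_cball: "compact (fls_cball (x :: 'a::{comm_ring_1,finite} fls) r)"
  unfolding compact_eq_totally_bounded
proof (intro conjI allI impI)
  show "complete (fls_cball x r)"
  proof (rule completeI)
    fix s assume s: "\<forall>n. s n \<in> fls_cball x r" and "Cauchy s"
    have "\<exists>N. \<forall>m\<ge>N. s m \<in> fls_cball (s N) k" for k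
    proof -
      have "(0::real) < 2 powi (- k)" by simp
      then obtain N where N: "\<And>m. m \<ge> N \<Longrightarrow> dist (s m) (s N) < 2 powi (- k)"
        using \<open>Cauchy s\<close> unfolding Cauchy_def by blast
      have "s m \<in> fls_cball (s N) k" if "m \<ge> N" for m
        using N[OF that] power_int_increasing[of "- k" "- fls_subdegree (s m - s N)" "2::real"]
        by (auto simp: dist_fls_powi mem_fls_cball_iff not_less[symmetric] split: if_splits)
      then show ?thesis by blast
    qed
    then obtain N where N: "\<And>k m. m \<ge> N k \<Longrightarrow> s m \<in> fls_cball (s (N k)) k"
      by metis
    \<comment> \<open>From \<open>N (i + 1)\<close> on, the coefficients of index at most
      \<open>i\<close> no longer change, so the limit takes its coefficient \<open>i\<close> from
      there.\<close>
    define l where "l = Abs_fls (\<lambda>i. s (N (i + 1)) $$ i)"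
    \<comment> \<open>A common lower bound for the supports, since all terms agree with
      \<open>x\<close> below \<open>r\<close>; it makes \<open>l\<close> a genuine Laurent
      series.\<close>
    define d where "d = min r (fls_subdegree x)"
    have "s n $$ i = 0" if "i < d" for n i
      using s that by (auto simp: fls_cball_def d_def)
    then have l: "l $$ i = s (N (i + 1)) $$ i" for i
      unfolding l_def by (intro nth_Abs_fls_lower_bound[of d]) auto
    have "l $$ i = s m $$ i" if "m \<ge> N k" "i < k" for i k m
    proof -
      define m' where "m' = max m (N (i + 1))"
      have "s m' $$ i = s (N (i + 1)) $$ i"
        using N[of "i + 1" m'] by (auto simp: fls_cball_def m'_def)
      moreover have "s m' \<in> fls_cball (s (N k)) k" "s m \<in> fls_cball (s (N k)) k"
        using N that by (auto simp: m'_def)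
      ultimately show ?thesis
        using that l[of i] by (auto simp: fls_cball_def)
    qed
    then have sl: "s m \<in> fls_cball l k" if "m \<ge> N k" for m k
      using that by (auto simp: fls_cball_def)
    have "l \<in> fls_cball x r"
      using sl[of r "N r"] s fls_cball_commute fls_cball_trans[of "s (N r)" x r l r r] by auto
    moreover have "s \<longlonglongrightarrow> l"
    proof (rule metric_LIMSEQ_I)
      fix e :: real assume "e > 0"
      then obtain n where n: "\<And>f. fls_cball (f :: 'a fls) (int n) \<subseteq> ball f e"
        using fls_cball_in_dist_ball by metis
      have "dist (s m) l < e" if "m \<ge> N (int n)" for m
        using sl[OF that] n[of l] by (auto simp: dist_commute)
      then show "\<exists>no. \<forall>n\<ge>no. dist (s n) l < e" by blast
    qed
    ultimately show "\<exists>l\<in>fls_cball x r. s \<longlonglongrightarrow> l" by blast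
  qed
next
  fix e :: real assume "e > 0"
  then obtain n where n: "\<And>f. fls_cball (f :: 'a fls) (int n) \<subseteq> ball f e"
    using fls_cball_in_dist_ball by metis
  obtain Y where Y: "finite Y" "fls_cball x r = (\<Union>y\<in>Y. fls_cball y (r + int (nat (int n - r))))"
    using fls_cball_partition[of x r "nat (int n - r)"] by blast
  have "fls_cball y (r + int (nat (int n - r))) \<subseteq> ball y e" for y :: "'a fls"
    by (rule subset_trans[OF fls_cball_mono n]) simp
  with Y show "\<exists>k. finite k \<and> fls_cball x r \<subseteq> (\<Union>x\<in>k. ball x e)"
    by (intro exI[of _ Y]) blast
qed

section \<open>Rational approximation\<close>

definition reduced_fractions :: "nat \<Rightarrow> 'a::field fls set" where
  "reduced_fractions m =
     {poly_to_fls_inv P / poly_to_fls_inv Q | P Q. Q \<noteq> 0 \<and> coprime P Q \<and> degree Q = m}"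

lemma fls_subdegree_divide_poly:
  "f \<noteq> 0 \<Longrightarrow> Q \<noteq> 0 \<Longrightarrow>
    fls_subdegree (f / poly_to_fls_inv Q) = fls_subdegree f + int (degree (Q :: 'a::field poly))"
  by (simp add: fls_divide_subdegree)

text \<open>A nonzero polynomial has absolute value at least 1, so unequal fractions differ by at
  least \<open>1 / |Q Q'|\<close>, which the \<open>+ 1\<close> in the level rules out.\<close>

lemma poly_fraction_separation:
  fixes P Q P' Q' :: "'a::field poly"
  assumes "Q \<noteq> 0" "Q' \<noteq> 0"
    and "poly_to_fls_inv P' / poly_to_fls_inv Q'
      \<in> fls_cball (poly_to_fls_inv P / poly_to_fls_inv Q) (int (degree Q + degree Q') + 1)"
  shows "P' * Q = P * Q'"
proof (rule ccontr)
  assume ne: "P' * Q \<noteq> P * Q'"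
  let ?x = "poly_to_fls_inv P / poly_to_fls_inv Q" and ?y = "poly_to_fls_inv P' / poly_to_fls_inv Q'"
  have eq: "?y - ?x = poly_to_fls_inv (P' * Q - P * Q') / poly_to_fls_inv (Q * Q')"
    using assms(1,2) by (simp add: poly_to_fls_inv_mult poly_to_fls_inv_diff field_simps)
  have "P' * Q - P * Q' \<noteq> 0" "Q * Q' \<noteq> 0"
    using ne assms(1,2) by auto
  then have "fls_subdegree (?y - ?x) = int (degree Q + degree Q') - int (degree (P' * Q - P * Q'))"
    and "?y - ?x \<noteq> 0"
    unfolding eq using assms(1,2)
    by (simp_all add: fls_subdegree_divide_poly degree_mult_eq)
  then show False
    using assms(3) by (simp add: mem_fls_cball_iff)
qed

text \<open>A nonzero element of least degree in the ideal generated by \<open>P\<close> and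
  \<open>Q\<close> divides both, hence is a unit.\<close>

lemma poly_bezout:
  fixes P Q :: "'a::field poly"
  assumes "coprime P Q" "Q \<noteq> 0"
  shows "\<exists>U V. U * P + V * Q = 1"
proof -
  define I where "I = {U * P + V * Q | U V. True}"
  have "Q \<in> I"
    unfolding I_def by (intro CollectI exI[of _ 0] exI[of _ 1]) simp
  then obtain D where D: "D \<in> I" "D \<noteq> 0" and min: "\<And>R. R \<in> I \<Longrightarrow> R \<noteq> 0 \<Longrightarrow> degree D \<le> degree R"
    using ex_has_least_nat[of "\<lambda>R. R \<in> I \<and> R \<noteq> 0" Q degree] assms by blast
  obtain U V where UV: "D = U * P + V * Q" using D by (auto simp: I_def)
  have dvd: "D dvd R" if R: "R \<in> I" for R
  proof (rule ccontr)
    assume "\<not> D dvd R"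
    then have "R mod D \<noteq> 0" by (simp add: mod_eq_0_iff_dvd)
    moreover obtain U' V' where "R = U' * P + V' * Q" using R by (auto simp: I_def)
    then have "R mod D = (U' - R div D * U) * P + (V' - R div D * V) * Q"
      by (simp add: minus_div_mult_eq_mod[symmetric] algebra_simps UV)
    then have "R mod D \<in> I" by (auto simp: I_def)
    ultimately show False
      using min[of "R mod D"] degree_mod_less[OF \<open>D \<noteq> 0\<close>, of R] by auto
  qed
  have "P \<in> I"
    unfolding I_def by (intro CollectI exI[of _ 1] exI[of _ 0]) simp
  with dvd \<open>Q \<in> I\<close> have "is_unit D"
    using assms(1) by (meson coprime_common_divisor)
  then obtain E where "E * D = 1" by (metis dvd_def mult.commute)
  then have "(E * U) * P + (E * V) * Q = 1"
    by (simp add: UV algebra_simps)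
  then show ?thesis by blast
qed

text \<open>By Bezout a reduced denominator divides every other denominator of the same fraction.
  Thus the degree of the reduced denominator is determined by the fraction.\<close>

lemma coprime_fraction_degree_le:
  fixes P Q P' Q' :: "'a::field poly"
  assumes "Q \<noteq> 0" "Q' \<noteq> 0" "coprime P Q" "P' * Q = P * Q'"
  shows "degree Q \<le> degree Q'"
proof -
  obtain U V where "U * P + V * Q = 1"
    using poly_bezout assms(1,3) by blast
  then have "Q' = U * (P * Q') + V * Q * Q'"
    by (metis distrib_right mult.assoc mult_1)
  also have "\<dots> = Q * (U * P' + V * Q')"
    by (simp add: assms(4)[symmetric] algebra_simps)
  finally have "Q dvd Q'" ..
  then show ?thesis
    using assms(2) by (rule dvd_imp_degree_le)
qed

text \<open>For \<open>m = n\<close> this makes the balls of level \<open>2 * m + 1\<close> around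
  the fractions disjoint, which is the source of all counting bounds. For
  \<open>m \<noteq> n\<close> it keeps fractions of different degrees apart.\<close>

lemma reduced_fractions_separation:
  fixes x y :: "'a::field fls"
  assumes "x \<in> reduced_fractions m" "y \<in> reduced_fractions n"
    and "y \<in> fls_cball x (int (m + n) + 1)"
  shows "x = y" "m = n"
proof -
  obtain P Q P' Q' where *: "x = poly_to_fls_inv P / poly_to_fls_inv Q" "Q \<noteq> 0" "coprime P Q"
    "degree Q = m" "y = poly_to_fls_inv P' / poly_to_fls_inv Q'" "Q' \<noteq> 0" "coprime P' Q'"
    "degree Q' = n"
    using assms(1,2) by (auto simp: reduced_fractions_def)
  have eq: "P' * Q = P * Q'"
    using poly_fraction_separation[of Q Q' P' P] assms(3) * by simp
  then have "poly_to_fls_inv P' * poly_to_fls_inv Q = poly_to_fls_inv P * poly_to_fls_inv Q'"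
    by (metis poly_to_fls_inv_mult)
  then show "x = y"
    using * by (simp add: frac_eq_eq)
  show "m = n"
    using coprime_fraction_degree_le[of Q Q' P P'] coprime_fraction_degree_le[of Q' Q P' P] eq *
    by (simp add: mult.commute)
qed

text \<open>Cancelling a common factor of \<open>P\<close> and \<open>Q\<close> only shrinks the
  error \<open>Q f - P\<close>, so a solution whose denominator has least degree is coprime.\<close>

lemma exists_coprime_fraction_near:
  fixes f :: "'a::field fls"
  assumes "Q \<noteq> 0" "degree Q \<le> n" "poly_to_fls_inv Q * f \<in> fls_cball (poly_to_fls_inv P) (int n + 1)"
  shows "\<exists>m\<le>n. \<exists>x\<in>reduced_fractions m. f \<in> fls_cball x (int (m + n) + 1)"
proof -
  define good where "good P Q \<longleftrightarrow> Q \<noteq> 0 \<and> degree Q \<le> n \<and>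
    poly_to_fls_inv Q * f \<in> fls_cball (poly_to_fls_inv P) (int n + 1)" for P Q
  have "\<exists>p. good (fst p) (snd p)"
    using assms by (auto simp: good_def)
  then obtain p where p: "good (fst p) (snd p)"
    and min: "\<And>p'. good (fst p') (snd p') \<Longrightarrow> degree (snd p) \<le> degree (snd p')"
    using ex_has_least_nat[of "\<lambda>p. good (fst p) (snd p)" _ "\<lambda>p. degree (snd p)"] by blast
  define P0 where "P0 = fst p"
  define Q0 where "Q0 = snd p"
  have good: "good P0 Q0" using p by (simp add: P0_def Q0_def)
  have min': "degree Q0 \<le> degree Q'" if "good P' Q'" for P' Q'
    using min[of "(P', Q')"] that by (simp add: Q0_def)
  have "coprime P0 Q0"
  proof (rule coprimeI)
    fix D assume "D dvd P0" "D dvd Q0"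
    then obtain P1 Q1 where D: "P0 = D * P1" "Q0 = D * Q1" by (auto elim!: dvdE)
    have ne: "D \<noteq> 0" "Q1 \<noteq> 0" using good D by (auto simp: good_def)
    then have deg: "degree Q0 = degree D + degree Q1" by (simp add: D degree_mult_eq)
    have eq: "poly_to_fls_inv Q0 * f - poly_to_fls_inv P0 =
        poly_to_fls_inv D * (poly_to_fls_inv Q1 * f - poly_to_fls_inv P1)"
      by (simp add: D poly_to_fls_inv_mult algebra_simps)
    have "poly_to_fls_inv Q1 * f \<in> fls_cball (poly_to_fls_inv P1) (int n + 1)"
    proof (cases "poly_to_fls_inv Q1 * f - poly_to_fls_inv P1 = 0")
      case False
      then have "fls_subdegree (poly_to_fls_inv Q0 * f - poly_to_fls_inv P0) =
        fls_subdegree (poly_to_fls_inv Q1 * f - poly_to_fls_inv P1) - int (degree D)"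
        and "poly_to_fls_inv Q0 * f - poly_to_fls_inv P0 \<noteq> 0"
        unfolding eq using ne by (simp_all del: right_minus_eq)
      then show ?thesis
        using good by (auto simp: good_def mem_fls_cball_iff)
    qed simp
    then have "good P1 Q1"
      using good deg ne by (simp add: good_def)
    from min'[OF this] deg have "degree D = 0" by simp
    then show "is_unit D"
      using ne by (simp add: is_unit_iff_degree)
  qed
  then have "poly_to_fls_inv P0 / poly_to_fls_inv Q0 \<in> reduced_fractions (degree Q0)"
    using good by (auto simp: reduced_fractions_def good_def)
  moreover have "f \<in> fls_cball (poly_to_fls_inv P0 / poly_to_fls_inv Q0) (int (degree Q0 + n) + 1)"
  proof (cases "f = poly_to_fls_inv P0 / poly_to_fls_inv Q0")
    case False
    have Q0: "Q0 \<noteq> 0" using good by (simp add: good_def)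
    have eq: "f - poly_to_fls_inv P0 / poly_to_fls_inv Q0 =
        (poly_to_fls_inv Q0 * f - poly_to_fls_inv P0) / poly_to_fls_inv Q0"
      using Q0 by (simp add: field_simps)
    have ne: "poly_to_fls_inv Q0 * f - poly_to_fls_inv P0 \<noteq> 0"
      using False Q0 by (auto simp: field_simps)
    then have "int n + 1 \<le> fls_subdegree (poly_to_fls_inv Q0 * f - poly_to_fls_inv P0)"
      using good by (auto simp: good_def mem_fls_cball_iff)
    then show ?thesis
      unfolding mem_fls_cball_iff eq fls_subdegree_divide_poly[OF ne Q0] by simp
  qed simp
  ultimately show ?thesis
    using good by (auto simp: good_def)
qed

text \<open>Pigeonhole: there are \<open>q^(n+1)\<close> polynomials of degree at most
  \<open>n\<close> but only \<open>q^n\<close> values for the coefficients of index 1 to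
  \<open>n\<close> of their products with \<open>f\<close>. The difference of two polynomials with
  the same value is the denominator sought.\<close>

lemma Dirichlet_approximation:
  fixes f :: "'a::{field,finite} fls"
  shows "\<exists>m\<le>n. \<exists>x\<in>reduced_fractions m. f \<in> fls_cball x (int (m + n) + 1)"
proof -
  define C :: "(nat \<Rightarrow> 'a) set" where "C = PiE {..n} (\<lambda>_. UNIV)"
  define p where "p c = (\<Sum>i\<le>n. monom (c i) i)" for c :: "nat \<Rightarrow> 'a"
  define T where "T c = (\<lambda>i\<in>{1..n}. (poly_to_fls_inv (p c) * f) $$ int i)" for c
  have "card (PiE {1..n} (\<lambda>_. UNIV :: 'a set)) < card C"
    using card_field_gt_1[where 'a='a] by (simp add: C_def card_PiE)
  moreover have "T ` C \<subseteq> PiE {1..n} (\<lambda>_. UNIV)"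
    by (auto simp: T_def)
  moreover have "finite (PiE {1..n} (\<lambda>_. UNIV :: 'a set))"
    by (intro finite_PiE) auto
  ultimately have "\<not> inj_on T C"
    by (meson card_inj_on_le linorder_not_le)
  then obtain c d where cd: "c \<in> C" "d \<in> C" "c \<noteq> d" "T c = T d"
    by (auto simp: inj_on_def)
  define Q where "Q = p c - p d"
  have coeff: "coeff Q k = (if k \<le> n then c k - d k else 0)" for k
    by (simp add: Q_def p_def coeff_sum_monom)
  have "Q \<noteq> 0"
  proof
    assume "Q = 0"
    have "c k = d k" if "k \<le> n" for k
      using coeff[of k] that \<open>Q = 0\<close> by simp
    then have "c = d"
      using cd by (auto simp: C_def intro: PiE_ext)
    with cd show False by simp
  qed
  moreover have "degree Q \<le> n"
    by (intro degree_le) (simp add: coeff)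
  moreover obtain P where P: "\<And>i. i \<le> 0 \<Longrightarrow> poly_to_fls_inv P $$ i = (poly_to_fls_inv Q * f) $$ i"
    using fls_poly_part by metis
  have "(poly_to_fls_inv Q * f) $$ i = 0" if "1 \<le> i" "i \<le> int n" for i
  proof -
    from that have "nat i \<in> {1..n}" "int (nat i) = i" by auto
    moreover have "T c (nat i) = T d (nat i)" using cd by simp
    ultimately show ?thesis
      by (simp add: T_def Q_def poly_to_fls_inv_diff left_diff_distrib)
  qed
  note zero = this
  have "poly_to_fls_inv Q * f \<in> fls_cball (poly_to_fls_inv P) (int n + 1)"
    unfolding fls_cball_def
  proof (intro CollectI allI impI)
    fix i assume "i < int n + 1"
    then show "(poly_to_fls_inv Q * f) $$ i = poly_to_fls_inv P $$ i"
      using P[of i] zero[of i] by (cases "i \<le> 0") (auto simp: poly_to_fls_inv_nth)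
  qed
  ultimately show ?thesis
    by (rule exists_coprime_fraction_near)
qed

section \<open>The orbit of infinity\<close>

definition orbit_fractions :: "('a::field poly ^ 2 ^ 2) set \<Rightarrow> nat \<Rightarrow> 'a fls set" where
  "orbit_fractions \<Gamma> m = {x \<in> reduced_fractions m. Fin x \<in> orbit_infty \<Gamma>}"

text \<open>Bezout supplies a second column. Subtracting a multiple of the first column keeps the
  determinant and reduces the lower right entry modulo \<open>Q\<close>; its small degree later
  prevents cancellation.\<close>

lemma SL2_completion:
  fixes P Q :: "'a::field poly"
  assumes "coprime P Q" "Q \<noteq> 0"
  shows "\<exists>g\<in>carrier SL2. g $ 1 $ 1 = P \<and> g $ 2 $ 1 = Q \<and>
    (g $ 2 $ 2 = 0 \<or> degree (g $ 2 $ 2) < degree Q)"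
proof -
  obtain U V where UV: "U * P + V * Q = 1" using poly_bezout[OF assms] by blast
  define g :: "'a poly ^ 2 ^ 2" where
    "g = vector [vector [P, - V - P * (U div Q)], vector [Q, U mod Q]]"
  have "P * (U mod Q) + P * (U div Q * Q) = P * U"
    by (simp flip: distrib_left)
  then have "g \<in> carrier SL2"
    using UV by (simp add: SL2_def g_def det_2 algebra_simps)
  then show ?thesis
    using degree_mod_less[OF assms(2), of U] by (intro bexI[of _ g]) (auto simp: g_def)
qed

text \<open>Right translation by \<open>h\<close> moves the coset \<open>c\<close> to \<open>\<Gamma>\<close>. The stabiliser of \<open>c\<close> in the infinite
  group of upper unipotent matrices is infinite, and multiplying \<open>h\<close> on the left by one of its
  elements with an entry of large degree makes the upper left entry of \<open>h\<close> dominate.\<close>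

lemma rcoset_transporter:
  fixes \<Gamma> :: "('a::field poly ^ 2 ^ 2) set"
  assumes \<Gamma>: "subgroup \<Gamma> SL2" and fin: "finite (rcosets\<^bsub>SL2\<^esub> \<Gamma>)"
    and c: "c \<in> rcosets\<^bsub>SL2\<^esub> \<Gamma>"
  shows "\<exists>h. h $ 1 $ 1 \<noteq> 0 \<and> degree (h $ 2 $ 1) \<le> degree (h $ 1 $ 1) \<and> (\<forall>g\<in>c. g ** h \<in> \<Gamma>)"
proof -
  interpret group "SL2 :: ('a poly ^ 2 ^ 2) monoid" by (rule group_SL2)
  let ?G = "SL2 :: ('a poly ^ 2 ^ 2) monoid"
  obtain g0 where g0: "g0 \<in> carrier ?G" "c = \<Gamma> #>\<^bsub>?G\<^esub> g0"
    using c by (auto simp: RCOSETS_def)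
  define k where "k = inv\<^bsub>?G\<^esub> g0"
  have k: "k \<in> carrier ?G" using g0 by (simp add: k_def)
  define u :: "'a poly \<Rightarrow> 'a poly ^ 2 ^ 2" where "u a = vector [vector [1, a], vector [0, 1]]" for a
  have u: "u a \<in> carrier ?G" for a
    by (simp add: u_def SL2_def det_2)
  have mult: "x \<otimes>\<^bsub>?G\<^esub> y = x ** y" for x y by (simp add: SL2_def)
  have u_add: "u a \<otimes>\<^bsub>?G\<^esub> u b = u (a + b)" for a b
    unfolding mult
    by (simp add: u_def vec_eq_iff forall_2 matrix_matrix_mult_def sum_2 add.commute)
  have "u 0 = \<one>\<^bsub>?G\<^esub>"
    by (simp add: u_def SL2_def vec_eq_iff forall_2 mat_def)
  then have inv_u: "inv\<^bsub>?G\<^esub> (u a) = u (- a)" for a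
    using u u_add[of "- a" a] by (intro inv_equality) auto
  \<comment> \<open>Exponents from \<open>D\<close> on exceed the degrees in the first column of
    \<open>k\<close>, so that the term with factor \<open>a\<close> will dominate.\<close>
  define D where "D = Suc (degree (k $ 1 $ 1) + degree (k $ 2 $ 1))"
  \<comment> \<open>Infinitely many exponents meet finitely many cosets, so two unipotent translates
    of \<open>g0\<close> share a coset.\<close>
  have "\<not> inj_on (\<lambda>j. \<Gamma> #>\<^bsub>?G\<^esub> (g0 \<otimes>\<^bsub>?G\<^esub> u (monom 1 j))) {D..}"
  proof
    assume "inj_on (\<lambda>j. \<Gamma> #>\<^bsub>?G\<^esub> (g0 \<otimes>\<^bsub>?G\<^esub> u (monom 1 j))) {D..}"
    moreover have "(\<lambda>j. \<Gamma> #>\<^bsub>?G\<^esub> (g0 \<otimes>\<^bsub>?G\<^esub> u (monom 1 j))) ` {D..} \<subseteq> rcosets\<^bsub>?G\<^esub> \<Gamma>"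
      using g0 u by (auto simp: RCOSETS_def)
    ultimately show False
      using fin infinite_Ici[of D] inj_on_finite by blast
  qed
  then obtain i j where ij: "D \<le> i" "i < j"
    "\<Gamma> #>\<^bsub>?G\<^esub> (g0 \<otimes>\<^bsub>?G\<^esub> u (monom 1 i)) = \<Gamma> #>\<^bsub>?G\<^esub> (g0 \<otimes>\<^bsub>?G\<^esub> u (monom 1 j))"
    unfolding inj_on_def by (metis atLeast_iff linorder_neqE_nat)
  define a :: "'a poly" where "a = monom 1 j - monom 1 i"
  have deg_a: "degree a = j"
    using ij(2) unfolding a_def diff_conv_add_uminus
    by (subst degree_add_eq_left) (simp_all add: degree_monom_eq)
  have "g0 \<otimes>\<^bsub>?G\<^esub> u (monom 1 j) \<in> \<Gamma> #>\<^bsub>?G\<^esub> (g0 \<otimes>\<^bsub>?G\<^esub> u (monom 1 i))"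
    unfolding ij(3) using g0 u \<Gamma> by (intro rcos_self) auto
  then have "(g0 \<otimes>\<^bsub>?G\<^esub> u (monom 1 j)) \<otimes>\<^bsub>?G\<^esub> inv\<^bsub>?G\<^esub> (g0 \<otimes>\<^bsub>?G\<^esub> u (monom 1 i)) \<in> \<Gamma>"
    using subgroup.rcos_module_imp[OF \<Gamma> group_SL2] g0 u by blast
  moreover have "(g0 \<otimes>\<^bsub>?G\<^esub> u (monom 1 j)) \<otimes>\<^bsub>?G\<^esub> inv\<^bsub>?G\<^esub> (g0 \<otimes>\<^bsub>?G\<^esub> u (monom 1 i)) =
      g0 \<otimes>\<^bsub>?G\<^esub> (u a \<otimes>\<^bsub>?G\<^esub> k)"
  proof -
    have "u a = u (monom 1 j) \<otimes>\<^bsub>?G\<^esub> u (- monom 1 i)"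
      by (simp add: u_add a_def)
    then show ?thesis
      using g0 u k by (simp add: inv_mult_group inv_u k_def m_assoc)
  qed
  \<comment> \<open>This says that right translation by \<open>u a\<close> fixes the coset
    \<open>c\<close>.\<close>
  ultimately have stab: "g0 \<otimes>\<^bsub>?G\<^esub> (u a \<otimes>\<^bsub>?G\<^esub> k) \<in> \<Gamma>" by simp
  define h where "h = u a \<otimes>\<^bsub>?G\<^esub> k"
  have h11: "h $ 1 $ 1 = k $ 1 $ 1 + a * k $ 2 $ 1" and h21: "h $ 2 $ 1 = k $ 2 $ 1"
    unfolding h_def mult by (simp_all add: u_def matrix_matrix_mult_def sum_2)
  have "h $ 1 $ 1 \<noteq> 0 \<and> degree (h $ 2 $ 1) \<le> degree (h $ 1 $ 1)"
  \<comment> \<open>If the lower left entry vanishes, determinant 1 makes the upper left entry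
    nonzero; otherwise the product with \<open>a\<close> outweighs both entries of the
    column.\<close>
  proof (cases "k $ 2 $ 1 = 0")
    case True
    then show ?thesis
      using k by (auto simp: h11 h21 SL2_def det_2)
  next
    case False
    have "a \<noteq> 0" using deg_a ij(2) by auto
    then have "degree (a * k $ 2 $ 1) = j + degree (k $ 2 $ 1)"
      using False deg_a by (simp add: degree_mult_eq)
    moreover have "degree (k $ 1 $ 1) < j" using ij by (simp add: D_def)
    ultimately have "degree (h $ 1 $ 1) = j + degree (k $ 2 $ 1)"
      unfolding h11 by (subst degree_add_eq_right) auto
    then show ?thesis
      using ij(2) by (auto simp: h21)
  qed
  moreover have "g ** h \<in> \<Gamma>" if gc: "g \<in> c" for g
  proof -
    obtain \<gamma> where \<gamma>: "\<gamma> \<in> \<Gamma>" "g = \<gamma> \<otimes>\<^bsub>?G\<^esub> g0"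
      using gc g0 by (auto simp: r_coset_def)
    then have "g ** h = \<gamma> \<otimes>\<^bsub>?G\<^esub> (g0 \<otimes>\<^bsub>?G\<^esub> h)"
      by (simp add: mult matrix_mul_assoc)
    then show ?thesis
      using \<gamma> stab subgroup.m_closed[OF \<Gamma>] by (simp add: h_def)
  qed
  ultimately show ?thesis by blast
qed

text \<open>The homography of \<open>\<gamma>\<close> sends infinity to the quotient of the first
  column, and determinant 1 makes this quotient reduced.\<close>

lemma orbit_fractions_first_column:
  fixes \<gamma> :: "'a::field poly ^ 2 ^ 2"
  assumes "subgroup \<Gamma> SL2" "\<gamma> \<in> \<Gamma>" "\<gamma> $ 2 $ 1 \<noteq> 0"
  shows "poly_to_fls_inv (\<gamma> $ 1 $ 1) / poly_to_fls_inv (\<gamma> $ 2 $ 1)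
    \<in> orbit_fractions \<Gamma> (degree (\<gamma> $ 2 $ 1))"
proof -
  have "det \<gamma> = 1"
    using subgroup.subset[OF assms(1)] assms(2) by (auto simp: SL2_def)
  then have det: "\<gamma> $ 1 $ 1 * \<gamma> $ 2 $ 2 - \<gamma> $ 1 $ 2 * \<gamma> $ 2 $ 1 = 1"
    by (simp add: det_2)
  have "coprime (\<gamma> $ 1 $ 1) (\<gamma> $ 2 $ 1)"
  proof (rule coprimeI)
    fix D assume "D dvd \<gamma> $ 1 $ 1" "D dvd \<gamma> $ 2 $ 1"
    then have "D dvd \<gamma> $ 1 $ 1 * \<gamma> $ 2 $ 2 - \<gamma> $ 1 $ 2 * \<gamma> $ 2 $ 1"
      by simp
    then show "is_unit D" by (simp add: det)
  qed
  then have "poly_to_fls_inv (\<gamma> $ 1 $ 1) / poly_to_fls_inv (\<gamma> $ 2 $ 1)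
    \<in> reduced_fractions (degree (\<gamma> $ 2 $ 1))"
    using assms(3) by (auto simp: reduced_fractions_def)
  moreover have "Fin (poly_to_fls_inv (\<gamma> $ 1 $ 1) / poly_to_fls_inv (\<gamma> $ 2 $ 1)) \<in> orbit_infty \<Gamma>"
    unfolding orbit_infty_def orbit_def using assms(2,3)
    by (auto intro!: exI[of _ \<gamma>])
  ultimately show ?thesis
    by (simp add: orbit_fractions_def)
qed

text \<open>If \<open>x = g \<infinity>\<close> and \<open>h\<close> moves the coset of
  \<open>g\<close> into \<open>\<Gamma>\<close>, then \<open>g h \<infinity>\<close> lies in the
  orbit. Only finitely many \<open>h\<close> occur, so the degree grows by a bounded amount.\<close>

lemma orbit_fraction_near_reduced_fraction:
  fixes \<Gamma> :: "('a::field poly ^ 2 ^ 2) set"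
  assumes \<Gamma>: "subgroup \<Gamma> SL2" and fin: "finite (rcosets\<^bsub>SL2\<^esub> \<Gamma>)"
  shows "\<exists>L. \<forall>m. \<forall>x\<in>reduced_fractions m. \<exists>d\<le>L. \<exists>y\<in>orbit_fractions \<Gamma> (m + d).
    y \<in> fls_cball x (2 * int m)"
proof -
  interpret group "SL2 :: ('a poly ^ 2 ^ 2) monoid" by (rule group_SL2)
  obtain h where h: "\<And>c. c \<in> rcosets\<^bsub>SL2\<^esub> \<Gamma> \<Longrightarrow> h c $ 1 $ 1 \<noteq> 0"
    "\<And>c. c \<in> rcosets\<^bsub>SL2\<^esub> \<Gamma> \<Longrightarrow> degree (h c $ 2 $ 1) \<le> degree (h c $ 1 $ 1)"
    "\<And>c g. c \<in> rcosets\<^bsub>SL2\<^esub> \<Gamma> \<Longrightarrow> g \<in> c \<Longrightarrow> g ** h c \<in> \<Gamma>"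
    using rcoset_transporter[OF assms] by metis
  \<comment> \<open>The sum over the finitely many cosets serves as an upper bound for each single
    degree.\<close>
  define L where "L = (\<Sum>c\<in>rcosets\<^bsub>SL2\<^esub> \<Gamma>. degree (h c $ 1 $ 1))"
  show ?thesis
  proof (rule exI[of _ L], intro allI ballI)
    fix m and x :: "'a fls" assume "x \<in> reduced_fractions m"
    then obtain P Q where PQ: "x = poly_to_fls_inv P / poly_to_fls_inv Q" "Q \<noteq> 0" "coprime P Q"
      "degree Q = m" by (auto simp: reduced_fractions_def)
    obtain g where g: "g \<in> carrier SL2" "g $ 1 $ 1 = P" "g $ 2 $ 1 = Q"
      "g $ 2 $ 2 = 0 \<or> degree (g $ 2 $ 2) < degree Q"
      using SL2_completion[OF PQ(3,2)] by blast
    define c where "c = \<Gamma> #>\<^bsub>SL2\<^esub> g"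
    have c: "c \<in> rcosets\<^bsub>SL2\<^esub> \<Gamma>" "g \<in> c"
      using g(1) rcos_self[OF g(1) \<Gamma>] by (auto simp: c_def RCOSETS_def)
    define H1 where "H1 = h c $ 1 $ 1"
    define H2 where "H2 = h c $ 2 $ 1"
    have H: "H1 \<noteq> 0" "degree H2 \<le> degree H1"
      using h(1,2)[OF c(1)] by (simp_all add: H1_def H2_def)
    define \<gamma> where "\<gamma> = g ** h c"
    define P0 where "P0 = g $ 1 $ 2"
    define Q0 where "Q0 = g $ 2 $ 2"
    have \<gamma>: "\<gamma> \<in> \<Gamma>" using h(3)[OF c] by (simp add: \<gamma>_def)
    have \<gamma>1: "\<gamma> $ 1 $ 1 = P * H1 + P0 * H2" and \<gamma>2: "\<gamma> $ 2 $ 1 = Q * H1 + Q0 * H2"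
      by (simp_all add: \<gamma>_def matrix_matrix_mult_def sum_2 g H1_def H2_def P0_def Q0_def)
    have det: "P * Q0 - P0 * Q = 1"
      using g by (simp add: SL2_def det_2 P0_def Q0_def)
    have QH: "degree (Q * H1) = m + degree H1" "Q * H1 \<noteq> 0"
      using PQ H by (simp_all add: degree_mult_eq)
    \<comment> \<open>Since \<open>Q0\<close> has smaller degree than \<open>Q\<close> and
      \<open>H2\<close> at most that of \<open>H1\<close>, the term \<open>Q * H1\<close> alone
      determines the degree.\<close>
    have deg: "degree (\<gamma> $ 2 $ 1) = m + degree H1"
    proof (cases "Q0 * H2 = 0")
      case False
      then have "degree (Q0 * H2) < degree (Q * H1)"
        using g(4) PQ(4) H QH by (auto simp: degree_mult_eq Q0_def)
      then show ?thesis
        unfolding \<gamma>2 using QH by (subst degree_add_eq_left) auto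
    next
      case True
      then have "\<gamma> $ 2 $ 1 = Q * H1"
        using \<gamma>2 by simp
      then show ?thesis
        using QH by simp
    qed
    have ne: "\<gamma> $ 2 $ 1 \<noteq> 0"
    proof
      assume *: "\<gamma> $ 2 $ 1 = 0"
      then have "Q * H1 = - (Q0 * H2)" using \<gamma>2 by (simp add: add_eq_0_iff2)
      then have "degree (Q * H1) = degree (Q0 * H2)" "Q0 * H2 \<noteq> 0"
        using QH by auto
      then show False
        using g(4) PQ(4) H QH by (auto simp: degree_mult_eq Q0_def)
    qed
    define y where "y = poly_to_fls_inv (\<gamma> $ 1 $ 1) / poly_to_fls_inv (\<gamma> $ 2 $ 1)"
    have "degree H1 \<le> L"
      unfolding L_def H1_def using fin c(1) by (intro member_le_sum) auto
    moreover have "y \<in> orbit_fractions \<Gamma> (m + degree H1)"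
      using orbit_fractions_first_column[OF \<Gamma> \<gamma> ne] by (simp add: y_def deg)
    moreover have "y \<in> fls_cball x (2 * int m)"
    proof (cases "y = x")
      case False
      \<comment> \<open>The terms with \<open>H1\<close> cancel and the determinant turns the rest
        into \<open>- H2\<close>. So \<open>y - x\<close> has absolute value at most
        \<open>q^(-2 m)\<close>, because \<open>degree H2 \<le> degree H1\<close>.\<close>
      have "\<gamma> $ 1 $ 1 * Q - P * \<gamma> $ 2 $ 1 = - (P * Q0 - P0 * Q) * H2"
        unfolding \<gamma>1 \<gamma>2 by (simp add: algebra_simps)
      then have num: "\<gamma> $ 1 $ 1 * Q - P * \<gamma> $ 2 $ 1 = - H2"
        using det by simp
      have "y - x = poly_to_fls_inv (\<gamma> $ 1 $ 1 * Q - P * \<gamma> $ 2 $ 1) / poly_to_fls_inv (\<gamma> $ 2 $ 1 * Q)"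
        using ne PQ(1,2)
        by (simp add: y_def poly_to_fls_inv_mult poly_to_fls_inv_diff diff_frac_eq)
      then have "y - x = poly_to_fls_inv (- H2) / poly_to_fls_inv (\<gamma> $ 2 $ 1 * Q)"
        unfolding num .
      moreover from this False have "H2 \<noteq> 0" by auto
      ultimately have "fls_subdegree (y - x) = int (m + (m + degree H1)) - int (degree H2)"
        using ne PQ deg by (simp add: fls_subdegree_divide_poly degree_mult_eq)
      then show ?thesis
        using H(2) by (simp add: mem_fls_cball_iff)
    qed simp
    ultimately show "\<exists>d\<le>L. \<exists>y\<in>orbit_fractions \<Gamma> (m + d). y \<in> fls_cball x (2 * int m)"
      by blast
  qed
qed

section \<open>Counting fractions with the Haar measure\<close>

locale fls_haar =
  fixes \<mu> :: "'a::{field,finite} fls measure"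
  assumes haar: "haar_measure \<mu>"
begin

definition q :: real where "q = real CARD('a)"

text \<open>The Haar measure is not normalised; \<open>c\<close> is the mass of the unit ball and
  enters every estimate as a factor.\<close>

definition c :: real where "c = measure \<mu> (fls_cball 0 0)"

lemma q_ge_2: "q \<ge> 2"
  using card_field_gt_1[where 'a='a] by (simp add: q_def)

lemma q_bounds [simp]: "q > 0" "q > 1" "q \<noteq> 0" "q \<ge> 0" "q \<ge> 1" "q \<noteq> 1"
  using q_ge_2 by auto

lemma q_powi_add: "q powi (m + n) = q powi m * q powi n"
  by (simp add: power_int_add)

lemma q_powi_mono: "m \<le> n \<Longrightarrow> q powi m \<le> q powi n"
  by (simp add: power_int_le_iff)

lemma q_powi_pos [simp]: "q powi n > 0"
  by simp

lemma q_powi_nonneg [simp]: "q powi n \<ge> 0"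
  by (rule less_imp_le) simp

lemma sets_haar: "sets \<mu> = sets borel"
  using haar by (simp add: haar_measure_def)

lemma open_in_sets: "open S \<Longrightarrow> S \<in> sets \<mu>"
  by (simp add: sets_haar)

lemma fls_cball_fmeasurable [simp]: "fls_cball x r \<in> fmeasurable \<mu>"
proof (rule fmeasurableI)
  show "fls_cball x r \<in> sets \<mu>"
    by (intro open_in_sets open_fls_cball)
  then show "emeasure \<mu> (fls_cball x r) < \<infinity>"
    using haar compact_fls_cball[of x r] by (simp add: haar_measure_def)
qed

lemma fls_cball_sets [simp]: "fls_cball x r \<in> sets \<mu>"
  using fls_cball_fmeasurable by (rule fmeasurableD)

lemma c_pos: "c > 0"
proof -
  have "emeasure \<mu> (fls_cball 0 0) > 0"
    using haar open_fls_cball[of 0 0] centre_in_fls_cball[of 0 0]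
    unfolding haar_measure_def by blast
  then show ?thesis
    using fmeasurableD2[OF fls_cball_fmeasurable[of 0 0]]
    by (simp add: c_def measure_def enn2real_positive_iff less_top)
qed

lemma measure_fls_cball_centre: "measure \<mu> (fls_cball x r) = measure \<mu> (fls_cball 0 r)"
proof -
  have "emeasure \<mu> ((\<lambda>f. x + f) ` fls_cball 0 r) = emeasure \<mu> (fls_cball 0 r)"
    using haar fls_cball_sets[of 0 r] by (simp add: haar_measure_def)
  then show ?thesis
    by (simp add: fls_cball_translate measure_def)
qed

text \<open>A ball splits into \<open>q\<close> translates of the next smaller one, so raising the
  level by one divides the measure by \<open>q\<close>. Induction runs in both directions from level
  0.\<close>

lemma measure_fls_cball: "measure \<mu> (fls_cball x r) = c * q powi (- r)"
proof -
  have step: "measure \<mu> (fls_cball 0 r) = q * measure \<mu> (fls_cball 0 (r + 1))" for r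
  proof -
    have "measure \<mu> (fls_cball 0 r) =
        measure \<mu> (\<Union>a. fls_cball (0 + fls_shift (- r) (fls_const a) :: 'a fls) (r + 1))"
      by (simp only: fls_cball_split(1)[of 0 r])
    also have "\<dots> = (\<Sum>a\<in>UNIV. measure \<mu> (fls_cball (0 + fls_shift (- r) (fls_const a)) (r + 1)))"
      using fmeasurableD2[OF fls_cball_fmeasurable]
      by (intro measure_finite_Union fls_cball_split(2)) auto
    also have "\<dots> = q * measure \<mu> (fls_cball 0 (r + 1))"
      by (simp add: measure_fls_cball_centre[of "fls_shift _ _"] q_def)
    finally show ?thesis .
  qed
  have "measure \<mu> (fls_cball 0 r) = c * q powi (- r)"
  proof (induction r rule: int_induct[where k = 0])
    case base
    show ?case by (simp add: c_def)
  next
    case (step1 i)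
    then show ?case
      using step[of i] by (simp add: power_int_diff power_int_add power_int_minus field_simps)
  next
    case (step2 i)
    then show ?case
      using step[of "i - 1"] by (simp add: power_int_diff power_int_add power_int_minus field_simps)
  qed
  then show ?thesis
    by (simp add: measure_fls_cball_centre[of x])
qed

lemma measure_UN_fls_cball_le:
  assumes "finite S"
  shows "measure \<mu> (\<Union>x\<in>S. fls_cball x s) \<le> real (card S) * (c * q powi (- s))"
  using measure_UNION_le[of S "\<lambda>x. fls_cball x s" \<mu>] assms by (simp add: measure_fls_cball)

lemma measure_UN_fls_cball:
  assumes "finite S" and "\<And>x y. x \<in> S \<Longrightarrow> y \<in> S \<Longrightarrow> y \<in> fls_cball x s \<Longrightarrow> x = y"
  shows "measure \<mu> (\<Union>x\<in>S. fls_cball x s) = real (card S) * (c * q powi (- s))"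
proof -
  have "disjoint_family_on (\<lambda>x. fls_cball x s) S"
    unfolding disjoint_family_on_def
    using assms(2) fls_cball_eq centre_in_fls_cball by (metis disjoint_iff)
  then have "measure \<mu> (\<Union>x\<in>S. fls_cball x s) = (\<Sum>x\<in>S. measure \<mu> (fls_cball x s))"
    using assms(1) fmeasurableD2[OF fls_cball_fmeasurable]
    by (intro measure_finite_Union) auto
  then show ?thesis
    by (simp add: measure_fls_cball)
qed

lemma fmeasurable_UN_fls_cball:
  "S \<subseteq> fls_cball x r \<Longrightarrow> r \<le> s \<Longrightarrow> (\<Union>x\<in>S. fls_cball x s) \<in> fmeasurable \<mu>"
  by (rule fmeasurableI2[of "fls_cball x r"])
    (auto intro!: open_in_sets open_UN open_fls_cball dest: fls_cball_subset)

text \<open>Packing: disjoint balls of level \<open>s\<close> around the points of \<open>S\<close>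
  fit into the given ball. A uniform bound for finite subsets also yields finiteness of
  \<open>S\<close>.\<close>

lemma separated_card_le:
  fixes S :: "'a fls set"
  assumes "S \<subseteq> fls_cball x r" "r \<le> s"
    and "\<And>x y. x \<in> S \<Longrightarrow> y \<in> S \<Longrightarrow> y \<in> fls_cball x s \<Longrightarrow> x = y"
  shows "finite S \<and> real (card S) * q powi (- s) \<le> q powi (- r)"
proof -
  have bound: "real (card T) * q powi (- s) \<le> q powi (- r)" if T: "finite T" "T \<subseteq> S" for T
  proof -
    have "real (card T) * (c * q powi (- s)) = measure \<mu> (\<Union>x\<in>T. fls_cball x s)"
      using T assms(3) by (intro measure_UN_fls_cball[symmetric]) auto
    also have "\<dots> \<le> measure \<mu> (fls_cball x r)"
    proof (rule measure_mono_fmeasurable)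
      show "(\<Union>x\<in>T. fls_cball x s) \<subseteq> fls_cball x r"
        using T assms(1,2) fls_cball_subset by blast
    qed (auto intro!: open_in_sets open_fls_cball)
    finally show ?thesis
      using c_pos by (simp add: measure_fls_cball)
  qed
  have "card T \<le> nat \<lfloor>q powi (- r) / q powi (- s)\<rfloor>" if "T \<subseteq> S" "finite T" for T
    using bound[OF that(2,1)] by (simp add: le_nat_floor field_simps)
  then have "finite S"
    by (meson finite_if_finite_subsets_card_bdd)
  with bound show ?thesis by blast
qed

lemma reduced_fractions_in_ball:
  fixes x :: "'a fls"
  assumes "r \<le> 2 * int m + 1"
  shows "finite (reduced_fractions m \<inter> fls_cball x r)"
    and "real (card (reduced_fractions m \<inter> fls_cball x r)) * q powi (- (2 * int m + 1)) \<le> q powi (- r)"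
proof -
  have "finite (reduced_fractions m \<inter> fls_cball x r) \<and>
    real (card (reduced_fractions m \<inter> fls_cball x r)) * q powi (- (2 * int m + 1)) \<le> q powi (- r)"
    using assms by (intro separated_card_le) (auto intro: reduced_fractions_separation(1)[of _ m _ m])
  then show "finite (reduced_fractions m \<inter> fls_cball x r)"
    and "real (card (reduced_fractions m \<inter> fls_cball x r)) * q powi (- (2 * int m + 1)) \<le> q powi (- r)"
    by auto
qed

lemma reduced_fractions_in_small_ball:
  fixes x :: "'a fls"
  assumes "2 * int m + 1 < r"
  shows "finite (reduced_fractions m \<inter> fls_cball x r)"
    and "card (reduced_fractions m \<inter> fls_cball x r) \<le> 1"
proof -
  have eq: "y = z" if "y \<in> reduced_fractions m \<inter> fls_cball x r" "z \<in> reduced_fractions m \<inter> fls_cball x r"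
    for y z
  proof -
    have "z \<in> fls_cball y (int (m + m) + 1)"
      using that assms fls_cball_commute[of y x r] by (auto intro: fls_cball_trans)
    then show ?thesis
      using that reduced_fractions_separation(1)[of y m z m] by auto
  qed
  then have "is_singleton (reduced_fractions m \<inter> fls_cball x r) \<or> reduced_fractions m \<inter> fls_cball x r = {}"
    by (metis is_singletonI' )
  then show "finite (reduced_fractions m \<inter> fls_cball x r)"
    and "card (reduced_fractions m \<inter> fls_cball x r) \<le> 1"
    by (auto simp: is_singleton_def)
qed

lemma finite_reduced_fractions_in_ball:
  "finite (reduced_fractions m \<inter> fls_cball (x :: 'a fls) r)"
  using reduced_fractions_in_ball(1) reduced_fractions_in_small_ball(1) by (metis linorder_not_le)

text \<open>Packing gives the power of \<open>q\<close> down to the separation scale; the summand 1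
  covers smaller balls, which hold at most one fraction.\<close>

lemma card_reduced_fractions_in_ball:
  fixes x :: "'a fls"
  shows "real (card (reduced_fractions m \<inter> fls_cball x r)) \<le> 1 + q powi (2 * int m + 1 - r)"
proof (cases "r \<le> 2 * int m + 1")
  case True
  then have "real (card (reduced_fractions m \<inter> fls_cball x r)) \<le> q powi (2 * int m + 1 - r)"
    using reduced_fractions_in_ball(2)[OF True, of x]
    by (simp add: power_int_minus power_int_diff power_int_add field_simps)
  then show ?thesis by simp
next
  case False
  then have "real (card (reduced_fractions m \<inter> fls_cball x r)) \<le> 1"
    using reduced_fractions_in_small_ball(2)[of m r x] by simp
  then show ?thesis
    by (simp add: add_increasing2)
qed

text \<open>Fractions with a denominator of larger degree than that of \<open>x\<close> keep away from \<open>x\<close>, so a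
  ball around \<open>x\<close> that meets one of the smaller balls contains its centre.\<close>

lemma measure_ball_Int_UN_le:
  assumes x: "x \<in> reduced_fractions n" and "n < m" "2 * int n + 1 \<le> s" "1 \<le> k"
  shows "measure \<mu> (fls_cball x s \<inter> (\<Union>y\<in>reduced_fractions m. fls_cball y (2 * int m + k)))
    \<le> c * q powi (1 - k) * q powi (- s)"
proof -
  define U :: "'a fls set" where "U = (\<Union>y\<in>reduced_fractions m. fls_cball y (2 * int m + k))"
  have near: "y \<in> fls_cball x s \<and> s \<le> int (n + m)"
    if y: "y \<in> reduced_fractions m" "z \<in> fls_cball x s" "z \<in> fls_cball y (2 * int m + k)" for y z
  proof -
    have far: "y \<notin> fls_cball x (int (n + m) + 1)"
      using reduced_fractions_separation(2)[OF x y(1)] \<open>n < m\<close> by auto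
    have "y \<in> fls_cball x (min s (2 * int m + k))"
      using y fls_cball_commute[of z y] by (auto intro: fls_cball_trans)
    \<comment> \<open>As \<open>n < m\<close> and \<open>k \<ge> 1\<close>, the level
      \<open>2 * m + k\<close> exceeds \<open>n + m\<close>, so only \<open>s\<close> can be the
      small argument of \<open>min\<close>.\<close>
    with far have "\<not> int (n + m) + 1 \<le> min s (2 * int m + k)"
      using fls_cball_mono by blast
    then have "s \<le> int (n + m)" "min s (2 * int m + k) = s"
      using assms by auto
    with \<open>y \<in> fls_cball x (min s (2 * int m + k))\<close> show ?thesis by simp
  qed
  show ?thesis
  proof (cases "fls_cball x s \<inter> U = {}")
    case True
    then show ?thesis
      using c_pos by (simp add: U_def)
  next
    case False
    then have s: "s \<le> int (n + m)"
      using near by (auto simp: U_def)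
    let ?S = "reduced_fractions m \<inter> fls_cball x s"
    have "measure \<mu> (fls_cball x s \<inter> U) \<le> measure \<mu> (\<Union>y\<in>?S. fls_cball y (2 * int m + k))"
    proof (rule measure_mono_fmeasurable)
      show "fls_cball x s \<inter> U \<subseteq> (\<Union>y\<in>?S. fls_cball y (2 * int m + k))"
        using near by (auto simp: U_def)
      show "fls_cball x s \<inter> U \<in> sets \<mu>"
        unfolding U_def by (intro open_in_sets open_Int open_UN ballI open_fls_cball)
      show "(\<Union>y\<in>?S. fls_cball y (2 * int m + k)) \<in> fmeasurable \<mu>"
        using s assms by (intro fmeasurable_UN_fls_cball[of _ x s]) auto
    qed
    also have "\<dots> \<le> real (card ?S) * (c * q powi (- (2 * int m + k)))"
      by (intro measure_UN_fls_cball_le finite_reduced_fractions_in_ball)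
    also have "\<dots> = c * q powi (1 - k) * (real (card ?S) * q powi (- (2 * int m + 1)))"
      by (simp add: power_int_diff power_int_minus power_int_add field_simps)
    also have "\<dots> \<le> c * q powi (1 - k) * q powi (- s)"
      using s assms c_pos by (intro mult_left_mono reduced_fractions_in_ball) auto
    finally show ?thesis by (simp add: U_def)
  qed
qed

lemma sum_powi_le: "(\<Sum>m\<le>n. q powi (int m - int n)) \<le> 2"
proof (induction n)
  case (Suc n)
  have "(\<Sum>m\<le>n. q powi (int m - int (Suc n))) = (\<Sum>m\<le>n. q powi (int m - int n)) / q"
    unfolding sum_divide_distrib
    by (intro sum.cong) (simp_all add: power_int_diff power_int_add field_simps)
  also have "\<dots> \<le> 2 / q"
    using Suc by (intro divide_right_mono) (simp_all add: less_imp_le)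
  also have "\<dots> \<le> 1"
    using q_ge_2 by simp
  finally show ?case by simp
qed simp

lemma sum_powi_minus_le: "(\<Sum>m\<le>n. q powi (- int m)) \<le> 2"
proof -
  have "(\<Sum>m\<le>n. q powi (- int m)) = (\<Sum>m\<le>n. q powi (int m - int n))"
    by (rule sum.reindex_bij_witness[of _ "\<lambda>m. n - m" "\<lambda>m. n - m"]) auto
  then show ?thesis
    using sum_powi_le by simp
qed

lemma UN_fls_cball: "(\<Union>j. fls_cball 0 (- int j)) = (UNIV :: 'a fls set)"
proof -
  have "f \<in> fls_cball 0 (- int (nat (- fls_subdegree f)))" for f :: "'a fls"
    by (simp add: mem_fls_cball_iff)
  then show ?thesis by blast
qed

lemma open_UN_fls_cball: "open (\<Union>x\<in>S. fls_cball (x :: 'a fls) s)"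
  by (intro open_UN ballI open_fls_cball)

text \<open>The number of fractions of each degree times the measure of their Dirichlet balls gives
  two geometric sums. Stopping at degree \<open>n - 3\<close> makes their total at most half of the
  ball.\<close>

lemma measure_low_degree_approximants:
  fixes x0 :: "'a fls"
  assumes "r + 2 \<le> int n" "3 \<le> n"
  shows "measure \<mu> (\<Union>m\<le>n - 3. \<Union>x\<in>reduced_fractions m \<inter> fls_cball x0 r. fls_cball x (int (m + n) + 1))
    \<le> c * q powi (- r) / 2"
proof -
  define S where "S m = reduced_fractions m \<inter> fls_cball x0 r" for m
  define p where "p = n - 3"
  have n: "int n = int p + 3" using assms by (simp add: p_def)
  have "measure \<mu> (\<Union>m\<le>p. \<Union>x\<in>S m. fls_cball x (int (m + n) + 1)) \<le>
      (\<Sum>m\<le>p. measure \<mu> (\<Union>x\<in>S m. fls_cball x (int (m + n) + 1)))"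
    by (intro measure_UNION_le) (auto intro!: open_in_sets open_UN_fls_cball)
  also have "\<dots> \<le> (\<Sum>m\<le>p. c * (q powi (- int n - 1) * q powi (- int m) + q powi (- r - 3) * q powi (int m - int p)))"
  proof (rule sum_mono)
    fix m
    have "measure \<mu> (\<Union>x\<in>S m. fls_cball x (int (m + n) + 1)) \<le>
        real (card (S m)) * (c * q powi (- (int (m + n) + 1)))"
      unfolding S_def by (intro measure_UN_fls_cball_le finite_reduced_fractions_in_ball)
    also have "\<dots> \<le> (1 + q powi (2 * int m + 1 - r)) * (c * q powi (- (int (m + n) + 1)))"
      unfolding S_def using c_pos by (intro mult_right_mono card_reduced_fractions_in_ball) auto
    \<comment> \<open>The summand 1 of the count gives the term decaying in \<open>m\<close>, the
      packing term the one growing up to \<open>m = p\<close>; the cut at \<open>n - 3\<close>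
      produces the factor \<open>q powi (- 3)\<close>.\<close>
    also have "\<dots> = c * (q powi (- int n - 1) * q powi (- int m) + q powi (- r - 3) * q powi (int m - int p))"
      unfolding n of_nat_add
      by (simp add: power_int_diff power_int_add power_int_minus power_int_numeral field_simps power2_eq_square
          power3_eq_cube power_int_mult) (simp add: eval_nat_numeral)
    finally show "measure \<mu> (\<Union>x\<in>S m. fls_cball x (int (m + n) + 1)) \<le> \<dots>" .
  qed
  also have "\<dots> = c * (q powi (- int n - 1) * (\<Sum>m\<le>p. q powi (- int m))
      + q powi (- r - 3) * (\<Sum>m\<le>p. q powi (int m - int p)))"
    by (simp add: sum_distrib_left sum.distrib distrib_left)
  \<comment> \<open>The assumption \<open>r + 2 \<le> n\<close> brings the first coefficient below
    the second.\<close>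
  also have "\<dots> \<le> c * (q powi (- r - 3) * 2 + q powi (- r - 3) * 2)"
    using c_pos assms(1)
    by (intro mult_left_mono add_mono mult_mono sum_powi_le sum_powi_minus_le q_powi_mono sum_nonneg)
      auto
  also have "\<dots> = c * q powi (- r) * (4 / q ^ 3)"
    by (simp add: power_int_diff)
  also have "\<dots> \<le> c * q powi (- r) * (1 / 2)"
  proof (intro mult_left_mono)
    have "2 ^ 3 \<le> q ^ 3" using q_ge_2 by (intro power_mono) auto
    then show "4 / q ^ 3 \<le> 1 / 2" by (simp add: field_simps)
  qed (use c_pos in auto)
  finally show ?thesis by (simp add: S_def p_def)
qed

text \<open>Dirichlet's theorem at height \<open>n + 2\<close> covers the ball. Degrees below
  \<open>n\<close> account for at most half of it, and fractions of degree \<open>n\<close> to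
  \<open>n + 2\<close> have orbit fractions nearby of degree at most \<open>n + 2 + L\<close>. If
  all these degrees held too few orbit fractions, part of the ball would stay uncovered.\<close>

lemma orbit_fractions_window:
  assumes "subgroup \<Gamma> SL2" "finite (rcosets\<^bsub>SL2\<^esub> (\<Gamma> :: ('a poly ^ 2 ^ 2) set))"
  shows "\<exists>\<eta>>0. \<exists>L. \<forall>x0 r. \<exists>n0. \<forall>n\<ge>n0. \<exists>m\<in>{n..n + L}.
    \<eta> * q powi (- r) \<le> real (card (orbit_fractions \<Gamma> m \<inter> fls_cball x0 r)) * q powi (- 2 * int m)"
proof -
  obtain L where L: "\<And>m x. x \<in> reduced_fractions m \<Longrightarrow>
      \<exists>d\<le>L. \<exists>y\<in>orbit_fractions \<Gamma> (m + d). y \<in> fls_cball x (2 * int m)"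
    using orbit_fraction_near_reduced_fraction[OF assms] by blast
  \<comment> \<open>With every count at the threshold, the \<open>L + 3\<close> degrees of the
    window and balls enlarged by \<open>q^(2 L)\<close> contribute exactly half of the ball.\<close>
  define \<eta> where "\<eta> = q powi (- 2 * int L) / (2 * (real L + 3))"
  have "\<eta> > 0" by (simp add: \<eta>_def)
  moreover have "\<exists>m\<in>{n..n + (L + 2)}. \<eta> * q powi (- r) \<le>
      real (card (orbit_fractions \<Gamma> m \<inter> fls_cball x0 r)) * q powi (- 2 * int m)"
    if n: "n \<ge> Suc (nat r + 2 * L)" for x0 r n
  proof (rule ccontr)
    assume *: "\<not> ?thesis"
    define F where "F m = orbit_fractions \<Gamma> m \<inter> fls_cball x0 r" for m
    define G where "G m = reduced_fractions m \<inter> fls_cball x0 r" for m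
    have fin: "finite (F m)" for m
      unfolding F_def orbit_fractions_def
      by (rule finite_subset[OF _ finite_reduced_fractions_in_ball[of m x0 r]]) auto
    define A1 where "A1 = (\<Union>m\<le>n + 2 - 3. \<Union>x\<in>G m. fls_cball x (int (m + (n + 2)) + 1))"
    \<comment> \<open>The level allows for the shift of degree: a point within
      \<open>q^(-2 m)\<close> of an orbit fraction of degree \<open>m + d\<close> satisfies
      \<open>2 m \<ge> 2 (m + d) - 2 L\<close>.\<close>
    define A2 where "A2 = (\<Union>m\<in>{n..n + (L + 2)}. \<Union>x\<in>F m. fls_cball x (2 * int m - 2 * int L))"
    have r: "r \<le> 2 * int m - 2 * int L" if "m \<ge> n" for m
      using n that by auto
    have cover: "fls_cball x0 r \<subseteq> A1 \<union> A2"
    proof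
      fix f assume f: "f \<in> fls_cball x0 r"
      obtain m x where x: "m \<le> n + 2" "x \<in> reduced_fractions m"
        "f \<in> fls_cball x (int (m + (n + 2)) + 1)"
        using Dirichlet_approximation by blast
      show "f \<in> A1 \<union> A2"
      proof (cases "m \<le> n + 2 - 3")
        case True
        have "x \<in> fls_cball x0 r"
          by (rule fls_cball_trans[OF f]) (use x(3) n in \<open>auto simp: fls_cball_commute[of x f]\<close>)
        then have "f \<in> A1"
          using True x by (auto simp: A1_def G_def)
        then show ?thesis by simp
      next
        case False
        with n x(1) have m: "n \<le> m" "m \<le> n + 2" by auto
        obtain d y where y: "d \<le> L" "y \<in> orbit_fractions \<Gamma> (m + d)" "y \<in> fls_cball x (2 * int m)"
          using L[OF x(2)] by blast
        have "x \<in> fls_cball f (2 * int m)"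
          using x(3) m fls_cball_mono[of "2 * int m" "int (m + (n + 2)) + 1" x]
          by (auto simp: fls_cball_commute[of x f])
        then have fy: "y \<in> fls_cball f (2 * int (m + d) - 2 * int L)"
          using y by (intro fls_cball_trans[of x f _ y]) auto
        moreover have "y \<in> fls_cball x0 r"
          using r[of "m + d"] m by (intro fls_cball_trans[OF f fy]) auto
        ultimately have "f \<in> A2"
          using y m by (auto simp: A2_def F_def fls_cball_commute[of f y] intro!: bexI[of _ "m + d"] bexI[of _ y])
        then show ?thesis by simp
      qed
    qed
    have A1: "A1 \<in> fmeasurable \<mu>"
      unfolding A1_def using n
      by (intro fmeasurable.finite_UN fmeasurable_UN_fls_cball[of _ x0 r]) (auto simp: G_def)
    have A2: "A2 \<in> fmeasurable \<mu>"
      unfolding A2_def using r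
      by (intro fmeasurable.finite_UN fmeasurable_UN_fls_cball[of _ x0 r]) (auto simp: F_def)
    have "measure \<mu> A2 \<le> (\<Sum>m\<in>{n..n + (L + 2)}. measure \<mu> (\<Union>x\<in>F m. fls_cball x (2 * int m - 2 * int L)))"
      unfolding A2_def by (intro measure_UNION_le) (auto intro!: open_in_sets open_UN_fls_cball)
    also have "\<dots> \<le> (\<Sum>m\<in>{n..n + (L + 2)}. real (card (F m)) * (c * q powi (- (2 * int m - 2 * int L))))"
      by (intro sum_mono measure_UN_fls_cball_le fin)
    also have "\<dots> < (\<Sum>m\<in>{n..n + (L + 2)}. c * q powi (2 * int L) * (\<eta> * q powi (- r)))"
    proof (rule sum_strict_mono)
      fix m assume "m \<in> {n..n + (L + 2)}"
      then have "real (card (F m)) * q powi (- 2 * int m) < \<eta> * q powi (- r)"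
        using * by (auto simp: F_def not_le)
      then have "c * q powi (2 * int L) * (real (card (F m)) * q powi (- 2 * int m)) <
          c * q powi (2 * int L) * (\<eta> * q powi (- r))"
        using c_pos by (intro mult_strict_left_mono) auto
      moreover have "q powi (- (2 * int m - 2 * int L)) = q powi (2 * int L) * q powi (- 2 * int m)"
        by (simp flip: q_powi_add)
      ultimately show "real (card (F m)) * (c * q powi (- (2 * int m - 2 * int L))) <
          c * q powi (2 * int L) * (\<eta> * q powi (- r))"
        by (simp only: mult_ac)
    qed auto
    also have "\<dots> = c * q powi (- r) * ((real L + 3) * q powi (2 * int L) * \<eta>)"
      by (simp add: algebra_simps)
    also have "(real L + 3) * q powi (2 * int L) * \<eta> = 1 / 2"
    proof -
      have "t * u * (v / (2 * t)) = v * u / 2" if "t \<noteq> 0" for t u v :: real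
        using that by simp
      from this[of "real L + 3"] show ?thesis
        by (simp add: \<eta>_def flip: q_powi_add)
    qed
    finally have "measure \<mu> A2 < c * q powi (- r) / 2" by simp
    moreover have "measure \<mu> A1 \<le> c * q powi (- r) / 2"
      unfolding A1_def G_def using n by (intro measure_low_degree_approximants) auto
    moreover have "measure \<mu> (A1 \<union> A2) \<le> measure \<mu> A1 + measure \<mu> A2"
      using A1 A2 by (intro measure_Un_le) auto
    moreover have "measure \<mu> (fls_cball x0 r) \<le> measure \<mu> (A1 \<union> A2)"
      using cover A1 A2 by (intro measure_mono_fmeasurable) auto
    ultimately show False
      by (simp add: measure_fls_cball)
  qed
  ultimately show ?thesis by blast
qed

text \<open>Borel-Cantelli on each ball of an exhaustion of the field, where packing bounds the
  measure at degree \<open>m\<close> by a constant times \<open>q powi (- k m)\<close>.\<close>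

lemma AE_finitely_many_close_fractions:
  assumes "summable (\<lambda>m. q powi (- k m))"
  shows "AE f in \<mu>. \<forall>\<^sub>F m in sequentially.
    f \<notin> (\<Union>x\<in>reduced_fractions m. fls_cball x (2 * int m + k m))"
proof -
  define U :: "nat \<Rightarrow> 'a fls set" where
    "U m = (\<Union>x\<in>reduced_fractions m. fls_cball x (2 * int m + k m))" for m
  have "(\<lambda>m. q powi (- k m)) \<longlonglongrightarrow> 0"
    using assms by (rule summable_LIMSEQ_zero)
  then have "\<forall>\<^sub>F m in sequentially. q powi (- k m) < 1"
    by (rule order_tendstoD) simp
  then obtain m0 where m0: "\<And>m. m \<ge> m0 \<Longrightarrow> q powi (- k m) < 1"
    by (auto simp: eventually_sequentially)
  \<comment> \<open>From \<open>m0\<close> on the balls around fractions are smaller than the fixed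
    ball, so their centres lie in it. Earlier degrees do not affect an eventual statement and are
    emptied in \<open>A\<close>.\<close>
  have k: "k m \<ge> 1" if "m \<ge> m0" for m
  proof (rule ccontr)
    assume "\<not> k m \<ge> 1"
    then have "q powi 0 \<le> q powi (- k m)"
      by (intro q_powi_mono) simp
    then show False
      using m0[OF that] by (metis linorder_not_le power_int_0_right)
  qed
  have "AE f in \<mu>. f \<in> fls_cball 0 (- int j) \<longrightarrow> (\<forall>\<^sub>F m in sequentially. f \<notin> U m)" for j
  proof -
    define A where "A m = (if m0 \<le> m then fls_cball 0 (- int j) \<inter> U m else {})" for m
    have A_sets: "A m \<in> sets \<mu>" for m
      by (cases "m0 \<le> m") (simp_all add: A_def U_def sets.Int open_in_sets open_UN_fls_cball)
    have A_meas: "A m \<in> fmeasurable \<mu>" for m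
      by (rule fmeasurableI2[OF fls_cball_fmeasurable[of 0 "- int j"] _ A_sets]) (auto simp: A_def)
    have bound: "measure \<mu> (A m) \<le> c * q powi int j * q * q powi (- k m)" if m: "m \<ge> m0" for m
    proof -
      let ?S = "reduced_fractions m \<inter> fls_cball (0 :: 'a fls) (- int j)"
      have "measure \<mu> (A m) \<le> measure \<mu> (\<Union>x\<in>?S. fls_cball x (2 * int m + k m))"
      proof (rule measure_mono_fmeasurable[OF _ A_sets])
        show "A m \<subseteq> (\<Union>x\<in>?S. fls_cball x (2 * int m + k m))"
        proof
          fix f assume "f \<in> A m"
          then obtain x where x: "f \<in> fls_cball 0 (- int j)" "x \<in> reduced_fractions m"
            "f \<in> fls_cball x (2 * int m + k m)"
            using m by (auto simp: A_def U_def)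
          then have "x \<in> fls_cball 0 (- int j)"
            using k[OF m] fls_cball_commute[of x f]
            by (intro fls_cball_trans[of f 0 _ x]) auto
          with x show "f \<in> (\<Union>x\<in>?S. fls_cball x (2 * int m + k m))" by blast
        qed
        show "(\<Union>x\<in>?S. fls_cball x (2 * int m + k m)) \<in> fmeasurable \<mu>"
          using k[OF m] by (intro fmeasurable_UN_fls_cball[of _ 0 "- int j"]) auto
      qed
      also have "\<dots> \<le> real (card ?S) * (c * q powi (- (2 * int m + k m)))"
        by (intro measure_UN_fls_cball_le finite_reduced_fractions_in_ball)
      also have "\<dots> = c * q * q powi (- k m) * (real (card ?S) * q powi (- (2 * int m + 1)))"
        by (simp add: power_int_diff power_int_minus power_int_add field_simps)
      also have "\<dots> \<le> c * q * q powi (- k m) * q powi (- (- int j))"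
        using c_pos by (intro mult_left_mono reduced_fractions_in_ball) auto
      finally show ?thesis by (simp add: mult_ac)
    qed
    have "summable (\<lambda>m. c * q powi int j * q * q powi (- k m))"
      using assms by (rule summable_mult)
    then have "summable (\<lambda>m. measure \<mu> (A m))"
      by (rule summable_comparison_test'[of _ m0]) (use bound in auto)
    then have "AE f in \<mu>. \<forall>\<^sub>F m in sequentially. f \<in> space \<mu> - A m"
      using fmeasurableD2[OF A_meas] by (intro borel_cantelli_AE1 A_sets) (simp_all add: less_top)
    then show ?thesis
    proof (rule AE_mp, intro AE_I2 impI)
      fix f :: "'a fls" assume f: "\<forall>\<^sub>F m in sequentially. f \<in> space \<mu> - A m" "f \<in> fls_cball 0 (- int j)"
      show "\<forall>\<^sub>F m in sequentially. f \<notin> U m"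
        using f(1) eventually_ge_at_top[of m0]
        by eventually_elim (use f(2) in \<open>auto simp: A_def\<close>)
    qed
  qed
  then have "AE f in \<mu>. \<forall>j. f \<in> fls_cball 0 (- int j) \<longrightarrow> (\<forall>\<^sub>F m in sequentially. f \<notin> U m)"
    unfolding AE_all_countable by blast
  then have "AE f in \<mu>. \<forall>\<^sub>F m in sequentially. f \<notin> U m"
  proof (rule AE_mp, intro AE_I2 impI)
    fix f assume *: "\<forall>j. f \<in> fls_cball 0 (- int j) \<longrightarrow> (\<forall>\<^sub>F m in sequentially. f \<notin> U m)"
    obtain j where "f \<in> fls_cball 0 (- int j)"
      using UN_fls_cball by blast
    with * show "\<forall>\<^sub>F m in sequentially. f \<notin> U m" by blast
  qed
  then show ?thesis by (simp add: U_def)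
qed

text \<open>Radii of balls are powers of \<open>q\<close>; rounding a positive bound up to such a
  power costs at most a factor \<open>q\<close>.\<close>

lemma exists_powi_between:
  assumes "t > 0"
  shows "\<exists>k. t \<le> q powi (- k) \<and> q powi (- k) \<le> q * t"
proof -
  define k where "k = \<lfloor>- log q t\<rfloor>"
  have powi: "q powi j = q powr (of_int j)" for j
    by (simp add: powr_real_of_int')
  have t: "t = q powr (log q t)"
    using assms by simp
  have "log q t \<le> of_int (- k)"
    by (simp add: k_def) linarith
  then have "t \<le> q powi (- k)"
    unfolding powi by (subst t) (intro powr_mono, auto)
  moreover have "of_int (- k) \<le> 1 + log q t"
    by (simp add: k_def) linarith
  then have "q powi (- k) \<le> q powr (1 + log q t)"
    unfolding powi by (intro powr_mono) auto
  then have "q powi (- k) \<le> q * t"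
    using assms by (simp add: powr_add)
  ultimately show ?thesis by blast
qed

end

section \<open>Divergence for abstract families of targets\<close>

text \<open>\<open>F m\<close> holds the admissible centres of degree \<open>m\<close>, and
  \<open>q powi (- k m)\<close> governs the density of their balls. \<open>window\<close> provides
  enough centres in some degree of each late window, and \<open>comparable\<close> makes it harmless
  which degree that is.\<close>

locale fls_targets = fls_haar \<mu> for \<mu> :: "'a::{field,finite} fls measure" +
  fixes F :: "nat \<Rightarrow> 'a fls set" and k :: "nat \<Rightarrow> int" and \<eta> K :: real and L :: nat
  assumes F_subset: "\<And>m. F m \<subseteq> reduced_fractions m"
    and k_ge_1: "\<And>m. k m \<ge> 1"
    and \<eta>_pos: "\<eta> > 0"
    and window: "\<And>x0 r. \<exists>n0. \<forall>n\<ge>n0. \<exists>m\<in>{n..n + L}.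
      \<eta> * q powi (- r) \<le> real (card (F m \<inter> fls_cball x0 r)) * q powi (- 2 * int m)"
    and comparable: "\<And>n d. d \<le> L \<Longrightarrow> q powi (- k n) \<le> K * q powi (- k (n + d))"
    and divergent: "\<not> summable (\<lambda>n. q powi (- k n))"
begin

definition good :: "'a fls \<Rightarrow> int \<Rightarrow> nat \<Rightarrow> bool" where
  "good x0 r m \<longleftrightarrow>
    \<eta> * q powi (- r) \<le> real (card (F m \<inter> fls_cball x0 r)) * q powi (- 2 * int m)"

definition hit :: "'a fls \<Rightarrow> int \<Rightarrow> nat \<Rightarrow> 'a fls set" where
  "hit x0 r m = (\<Union>x\<in>F m \<inter> fls_cball x0 r. fls_cball x (2 * int m + k m))"

text \<open>Each late window has a good degree, whose term is comparable to the one at the start of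
  the window. So the whole series is dominated by \<open>L + 1\<close> shifts of the restricted
  one.\<close>

lemma not_summable_good: "\<not> summable (\<lambda>m. if good x0 r m then q powi (- k m) else 0)"
proof
  define a where "a m = (if good x0 r m then q powi (- k m) else 0)" for m
  assume "summable (\<lambda>m. if good x0 r m then q powi (- k m) else 0)"
  then have "summable a" by (simp add: a_def[abs_def])
  \<comment> \<open>The case \<open>n = d = 0\<close> of \<open>comparable\<close> forces
    \<open>K \<ge> 1\<close>, which makes the dominating terms nonnegative.\<close>
  have "q powi (- k 0) \<le> K * q powi (- k 0)"
    using comparable[of 0 0] by simp
  then have K: "K \<ge> 1" by simp
  obtain n0 where n0: "\<And>n. n \<ge> n0 \<Longrightarrow> \<exists>m\<in>{n..n + L}. good x0 r m"
    using window[of r x0] unfolding good_def by blast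
  have "summable (\<lambda>n. \<Sum>d\<le>L. K * a (n + d))"
    using \<open>summable a\<close> by (intro summable_sum summable_mult) (simp add: summable_iff_shift)
  moreover have "norm (q powi (- k n)) \<le> (\<Sum>d\<le>L. K * a (n + d))" if n: "n \<ge> n0" for n
  proof -
    obtain m where m: "m \<in> {n..n + L}" "good x0 r m" using n0[OF n] by blast
    define d where "d = m - n"
    have d: "d \<le> L" "m = n + d" using m by (auto simp: d_def)
    have "q powi (- k n) \<le> K * a (n + d)"
      using comparable[OF d(1), of n] m d by (simp add: a_def)
    also have "\<dots> \<le> (\<Sum>d\<le>L. K * a (n + d))"
      using d K by (intro member_le_sum) (auto simp: a_def)
    finally show ?thesis by simp
  qed
  ultimately have "summable (\<lambda>n. q powi (- k n))"
    by (rule summable_comparison_test')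
  with divergent show False ..
qed

lemma finite_F_in_ball: "finite (F m \<inter> fls_cball x0 r)"
  by (rule finite_subset[OF _ finite_reduced_fractions_in_ball[of m x0 r]]) (use F_subset[of m] in auto)

lemma hit_fmeasurable: "r \<le> 2 * int m + k m \<Longrightarrow> hit x0 r m \<in> fmeasurable \<mu>"
  unfolding hit_def by (rule fmeasurable_UN_fls_cball) auto

lemma hit_sets: "hit x0 r m \<in> sets \<mu>"
  unfolding hit_def by (intro open_in_sets open_UN_fls_cball)

lemma hit_subset: "r \<le> 2 * int m + k m \<Longrightarrow> hit x0 r m \<subseteq> fls_cball x0 r"
  unfolding hit_def by (intro UN_least fls_cball_subset) auto

text \<open>Because \<open>k m \<ge> 1\<close>, the balls lie below the separation scale of degree
  \<open>m\<close>, so no mass is lost to overlaps.\<close>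

lemma measure_hit_good:
  assumes "good x0 r m"
  shows "\<eta> * c * q powi (- r) * q powi (- k m) \<le> measure \<mu> (hit x0 r m)"
proof -
  have "measure \<mu> (hit x0 r m) = real (card (F m \<inter> fls_cball x0 r)) * (c * q powi (- (2 * int m + k m)))"
    unfolding hit_def
  proof (intro measure_UN_fls_cball finite_F_in_ball)
    fix x y assume "x \<in> F m \<inter> fls_cball x0 r" "y \<in> F m \<inter> fls_cball x0 r"
      "y \<in> fls_cball x (2 * int m + k m)"
    then show "x = y"
      using F_subset[of m] k_ge_1[of m] fls_cball_mono[of "int (m + m) + 1" "2 * int m + k m" x]
      by (intro reduced_fractions_separation(1)[of x m y m]) auto
  qed
  also have "\<dots> = c * q powi (- k m) * (real (card (F m \<inter> fls_cball x0 r)) * q powi (- 2 * int m))"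
    by (simp add: power_int_diff power_int_minus field_simps)
  also have "\<dots> \<ge> c * q powi (- k m) * (\<eta> * q powi (- r))"
    using assms c_pos by (intro mult_left_mono) (auto simp: good_def)
  finally show ?thesis by (simp add: mult_ac)
qed

text \<open>Quasi-independence: the share of the overlap in the ball is at most a constant times the
  product of the two densities. The estimate around one centre of degree \<open>m\<close> is summed,
  with packing bounding the number of centres.\<close>

lemma measure_hit_Int_hit:
  assumes "m < n" "r \<le> 2 * int m + 1"
  shows "measure \<mu> (hit x0 r m \<inter> hit x0 r n) \<le> q\<^sup>2 * c * q powi (- r) * q powi (- k m) * q powi (- k n)"
proof -
  let ?S = "F m \<inter> fls_cball x0 r"
  let ?U = "\<Union>y\<in>reduced_fractions n. fls_cball y (2 * int n + k n)"
  have "measure \<mu> (hit x0 r m \<inter> hit x0 r n) \<le>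
      measure \<mu> (\<Union>x\<in>?S. fls_cball x (2 * int m + k m) \<inter> ?U)"
  proof (rule measure_mono_fmeasurable)
    show "hit x0 r m \<inter> hit x0 r n \<subseteq> (\<Union>x\<in>?S. fls_cball x (2 * int m + k m) \<inter> ?U)"
      using F_subset[of n] by (fastforce simp: hit_def)
    show "hit x0 r m \<inter> hit x0 r n \<in> sets \<mu>"
      by (intro sets.Int hit_sets)
    show "(\<Union>x\<in>?S. fls_cball x (2 * int m + k m) \<inter> ?U) \<in> fmeasurable \<mu>"
      by (intro fmeasurable.finite_UN finite_F_in_ball fmeasurable_Int_fmeasurable open_in_sets
          open_UN_fls_cball) auto
  qed
  also have "\<dots> \<le> (\<Sum>x\<in>?S. measure \<mu> (fls_cball x (2 * int m + k m) \<inter> ?U))"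
    by (intro measure_UNION_le finite_F_in_ball)
      (intro sets.Int fls_cball_sets open_in_sets open_UN_fls_cball)
  also have "\<dots> \<le> (\<Sum>x\<in>?S. c * q powi (1 - k n) * q powi (- (2 * int m + k m)))"
    using F_subset[of m] k_ge_1 assms(1)
    by (intro sum_mono measure_ball_Int_UN_le[of _ m]) auto
  also have "\<dots> = real (card ?S) * (c * q powi (1 - k n) * q powi (- (2 * int m + k m)))"
    by simp
  also have "\<dots> \<le> real (card (reduced_fractions m \<inter> fls_cball x0 r)) *
      (c * q powi (1 - k n) * q powi (- (2 * int m + k m)))"
    using F_subset[of m] c_pos
    by (intro mult_right_mono of_nat_mono card_mono finite_reduced_fractions_in_ball) auto
  also have "\<dots> = q\<^sup>2 * c * q powi (- k m) * q powi (- k n) *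
      (real (card (reduced_fractions m \<inter> fls_cball x0 r)) * q powi (- (2 * int m + 1)))"
    by (simp add: power_int_diff power_int_minus power_int_add field_simps power2_eq_square)
  also have "\<dots> \<le> q\<^sup>2 * c * q powi (- k m) * q powi (- k n) * q powi (- r)"
    using c_pos assms(2) by (intro mult_left_mono reduced_fractions_in_ball) auto
  finally show ?thesis by (simp add: mult_ac)
qed

text \<open>The product of the retained share \<open>\<eta> / 2\<close> and the threshold
  \<open>\<eta> / (2 q^2)\<close> in the next proof.\<close>

definition \<delta> :: real where "\<delta> = \<eta>\<^sup>2 / (4 * q\<^sup>2)"

text \<open>The sets \<open>hit x0 r m\<close> are added one by one until their total mass passes a threshold below
  which the pairwise overlaps cost at most half of the mass.\<close>

lemma measure_UN_hit_ge:
  "\<exists>J. finite J \<and> J \<subseteq> {M..} \<and> (\<forall>m\<in>J. r \<le> 2 * int m + k m) \<and>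
    \<delta> * (c * q powi (- r)) \<le> measure \<mu> (\<Union>m\<in>J. hit x0 r m)"
proof -
  \<comment> \<open>Degrees from \<open>nat r\<close> on satisfy \<open>r \<le> 2 * m + 1\<close>,
    as the packing bound requires.\<close>
  define M1 where "M1 = max M (nat r)"
  define I where "I = {m. M1 \<le> m \<and> good x0 r m}"
  have I: "good x0 r m" "M \<le> m" "r \<le> 2 * int m + 1" "r \<le> 2 * int m + k m" if "m \<in> I" for m
    using that k_ge_1[of m] by (auto simp: I_def M1_def)
  define g where "g m = (if m \<in> I then q powi (- k m) else 0)" for m
  have g_nonneg: "g m \<ge> 0" for m by (simp add: g_def)
  define V where "V n = (\<Union>m\<in>I \<inter> {..<n}. hit x0 r m)" for n
  \<comment> \<open>Chosen so that \<open>q^2 * \<tau> = \<eta> / 2\<close>: while the collected sum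
    is below \<open>\<tau>\<close>, overlaps take at most half of the mass guaranteed for the new
    set.\<close>
  define \<tau> where "\<tau> = \<eta> / (2 * q\<^sup>2)"
  define b where "b = c * q powi (- r)"
  have b: "b > 0" using c_pos by (simp add: b_def)
  have "\<not> summable g"
  proof
    assume "summable g"
    then have "summable (\<lambda>m. if good x0 r m then q powi (- k m) else 0)"
      by (rule summable_comparison_test'[of _ M1]) (auto simp: g_def I_def)
    with not_summable_good show False ..
  qed
  then obtain p' where "\<tau> \<le> sum g {..<p'}"
    using summableI_nonneg_bounded[of g \<tau>] g_nonneg by (meson linorder_le_cases)
  \<comment> \<open>Taking the first passage keeps every earlier partial sum below
    \<open>\<tau>\<close>, as each induction step needs.\<close>
  define p where "p = (LEAST p. \<tau> \<le> sum g {..<p})"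
  have p: "\<tau> \<le> sum g {..<p}"
    unfolding p_def using \<open>\<tau> \<le> sum g {..<p'}\<close> by (rule LeastI)
  have less: "sum g {..<n} < \<tau>" if "n < p" for n
    using that not_less_Least unfolding p_def by (metis linorder_not_le)
  have V_meas: "V n \<in> fmeasurable \<mu>" for n
    unfolding V_def using I by (intro fmeasurable.finite_UN hit_fmeasurable) auto
  have "\<eta> / 2 * b * sum g {..<n} \<le> measure \<mu> (V n)" if "n \<le> p" for n
    using that
  proof (induction n)
    case (Suc n)
    then have IH: "\<eta> / 2 * b * sum g {..<n} \<le> measure \<mu> (V n)" and n: "n < p" by auto
    show ?case
    proof (cases "n \<in> I")
      case False
      then have "V (Suc n) = V n" "g n = 0"
        by (auto simp: V_def g_def lessThan_Suc)
      with IH show ?thesis by simp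
    next
      case True
      have H: "hit x0 r n \<in> fmeasurable \<mu>"
        using I[OF True] by (intro hit_fmeasurable)
      have "measure \<mu> (V n \<inter> hit x0 r n) = measure \<mu> (\<Union>m\<in>I \<inter> {..<n}. hit x0 r m \<inter> hit x0 r n)"
        by (simp add: V_def)
      also have "\<dots> \<le> (\<Sum>m\<in>I \<inter> {..<n}. measure \<mu> (hit x0 r m \<inter> hit x0 r n))"
        by (intro measure_UNION_le sets.Int hit_sets) auto
      also have "\<dots> \<le> (\<Sum>m\<in>I \<inter> {..<n}. q\<^sup>2 * c * q powi (- r) * q powi (- k m) * q powi (- k n))"
        using I by (intro sum_mono measure_hit_Int_hit) auto
      also have "\<dots> = q\<^sup>2 * b * (\<Sum>m\<in>I \<inter> {..<n}. q powi (- k m)) * q powi (- k n)"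
        by (simp add: sum_distrib_left sum_distrib_right b_def mult_ac)
      also have "(\<Sum>m\<in>I \<inter> {..<n}. q powi (- k m)) = sum g {..<n}"
        unfolding g_def by (simp add: sum.If_cases Int_commute)
      also have "q\<^sup>2 * b * sum g {..<n} * q powi (- k n) \<le> q\<^sup>2 * b * \<tau> * q powi (- k n)"
        using b less[OF n] by (intro mult_right_mono mult_left_mono) auto
      also have "\<dots> = \<eta> / 2 * b * q powi (- k n)"
        by (simp add: \<tau>_def field_simps)
      finally have overlap: "measure \<mu> (V n \<inter> hit x0 r n) \<le> \<eta> / 2 * b * q powi (- k n)" .
      have "V (Suc n) = V n \<union> hit x0 r n"
        using True by (auto simp: V_def lessThan_Suc)
      then have "measure \<mu> (V (Suc n)) =
          measure \<mu> (V n) + measure \<mu> (hit x0 r n) - measure \<mu> (V n \<inter> hit x0 r n)"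
        using measure_Un3[OF V_meas H] by simp
      moreover have "\<eta> * b * q powi (- k n) \<le> measure \<mu> (hit x0 r n)"
        using measure_hit_good[OF I(1)[OF True]] by (simp add: b_def mult_ac)
      ultimately show ?thesis
        using IH overlap True by (simp add: g_def algebra_simps)
    qed
  qed simp
  from this[OF order_refl] have "\<eta> / 2 * b * sum g {..<p} \<le> measure \<mu> (V p)" .
  moreover have "\<delta> * b \<le> \<eta> / 2 * b * sum g {..<p}"
  proof -
    have "\<delta> * b = \<eta> / 2 * b * \<tau>"
      by (simp add: \<delta>_def \<tau>_def power2_eq_square)
    also have "\<dots> \<le> \<eta> / 2 * b * sum g {..<p}"
      using p b \<eta>_pos by (intro mult_left_mono) auto
    finally show ?thesis .
  qed
  ultimately have "\<delta> * b \<le> measure \<mu> (V p)" by simp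
  then show ?thesis
    using I unfolding V_def b_def by (intro exI[of _ "I \<inter> {..<p}"]) auto
qed

definition target :: "nat \<Rightarrow> 'a fls set" where
  "target m = (\<Union>x\<in>F m. fls_cball x (2 * int m + k m))"

lemma hit_subset_target: "hit x0 r m \<subseteq> target m"
  by (auto simp: hit_def target_def)

lemma target_sets: "target m \<in> sets \<mu>"
  unfolding target_def by (intro open_in_sets open_UN_fls_cball)

lemma \<delta>_pos: "\<delta> > 0"
  using \<eta>_pos by (simp add: \<delta>_def)

text \<open>The sets \<open>hit\<close> lie inside both the ball and the targets. As
  \<open>\<delta>\<close> depends on neither the ball nor \<open>M\<close>, the bound can be reused
  inside arbitrarily small balls.\<close>

lemma measure_avoid_le:
  "measure \<mu> (fls_cball x0 r - (\<Union>m\<in>{M..}. target m)) \<le> (1 - \<delta>) * measure \<mu> (fls_cball x0 r)"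
proof -
  obtain J where J: "finite J" "J \<subseteq> {M..}" "\<And>m. m \<in> J \<Longrightarrow> r \<le> 2 * int m + k m"
    "\<delta> * (c * q powi (- r)) \<le> measure \<mu> (\<Union>m\<in>J. hit x0 r m)"
    using measure_UN_hit_ge by metis
  let ?H = "\<Union>m\<in>J. hit x0 r m"
  have H: "?H \<in> fmeasurable \<mu>" "?H \<subseteq> fls_cball x0 r"
    using J hit_subset by (auto intro!: fmeasurable.finite_UN hit_fmeasurable) blast
  have "measure \<mu> (fls_cball x0 r - (\<Union>m\<in>{M..}. target m)) \<le> measure \<mu> (fls_cball x0 r - ?H)"
  proof (rule measure_mono_fmeasurable)
    show "fls_cball x0 r - (\<Union>m\<in>{M..}. target m) \<subseteq> fls_cball x0 r - ?H"
      using J(2) hit_subset_target by blast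
    show "fls_cball x0 r - (\<Union>m\<in>{M..}. target m) \<in> sets \<mu>"
      by (intro sets.Diff sets.countable_UN') (auto intro: target_sets)
    show "fls_cball x0 r - ?H \<in> fmeasurable \<mu>"
      using H by (intro fmeasurable_Diff) auto
  qed
  also have "\<dots> = measure \<mu> (fls_cball x0 r) - measure \<mu> ?H"
    using H fmeasurableD2[OF fls_cball_fmeasurable[of x0 r]] by (intro measure_Diff) auto
  also have "\<dots> \<le> (1 - \<delta>) * measure \<mu> (fls_cball x0 r)"
    using J(4) by (simp add: measure_fls_cball algebra_simps)
  finally show ?thesis .
qed

text \<open>The set of points of a ball that avoid all targets from \<open>M\<close> on is approximated from outside
  by the finite stages, which are finite unions of balls; by the preceding lemma it fills at most
  the proportion \<open>1 - \<delta>\<close> of each of them.\<close>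

lemma avoid_null: "fls_cball x0 r - (\<Union>m\<in>{M..}. target m) \<in> null_sets \<mu>"
proof -
  define T where "T = fls_cball x0 r - (\<Union>m\<in>{M..}. target m)"
  define T' where "T' p = fls_cball x0 r - (\<Union>m\<in>{M..<p}. target m)" for p
  have T'_sets: "T' p \<in> sets \<mu>" for p
    unfolding T'_def by (intro sets.Diff sets.countable_UN') (auto intro: target_sets)
  have T_sets: "T \<in> sets \<mu>"
    unfolding T_def by (intro sets.Diff sets.countable_UN') (auto intro: target_sets)
  have T'_meas: "T' p \<in> fmeasurable \<mu>" for p
    by (rule fmeasurableI2[OF fls_cball_fmeasurable[of x0 r] _ T'_sets]) (auto simp: T'_def)
  have T_meas: "T \<in> fmeasurable \<mu>"
    by (rule fmeasurableI2[OF fls_cball_fmeasurable[of x0 r] _ T_sets]) (auto simp: T_def)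
  have le: "measure \<mu> T \<le> (1 - \<delta>) * measure \<mu> (T' p)" for p
  proof -
    \<comment> \<open>This level is at least \<open>r\<close> and that of every target ball of
      degree in \<open>{M..<p}\<close>, so membership in \<open>T' p\<close> is constant on balls of
      level \<open>R\<close>.\<close>
    define R where "R = (\<Sum>m\<in>{M..<p}. \<bar>2 * int m + k m\<bar>) + \<bar>r\<bar>"
    have R_ge: "2 * int m + k m \<le> R" if "m \<in> {M..<p}" for m
      using that member_le_sum[of m "{M..<p}" "\<lambda>m. \<bar>2 * int m + k m\<bar>"] by (auto simp: R_def)
    have "0 \<le> (\<Sum>m\<in>{M..<p}. \<bar>2 * int m + k m\<bar>)" by (intro sum_nonneg) auto
    then have "r \<le> R" unfolding R_def by linarith
    then have "r + int (nat (R - r)) = R" by simp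
    then obtain Y where Y: "finite Y" "fls_cball x0 r = (\<Union>y\<in>Y. fls_cball y R)"
      "disjoint_family_on (\<lambda>y. fls_cball y R) Y"
      using fls_cball_partition[of x0 r "nat (R - r)"] by auto
    have invariant: "g \<in> T' p" if "f \<in> T' p" "g \<in> fls_cball f R" for f g
    proof -
      have "f \<in> target m" if m: "m \<in> {M..<p}" "g \<in> target m" for m
        using m R_ge[OF m(1)] \<open>g \<in> fls_cball f R\<close> fls_cball_commute[of g f R]
        by (auto simp: target_def intro: fls_cball_trans)
      moreover have "g \<in> fls_cball x0 r"
        using that \<open>r \<le> R\<close> by (auto simp: T'_def intro: fls_cball_trans)
      ultimately show ?thesis
        using \<open>f \<in> T' p\<close> unfolding T'_def by blast
    qed
    define Y' where "Y' = {y\<in>Y. y \<in> T' p}"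
    have Y': "finite Y'" "Y' \<subseteq> Y" using Y by (auto simp: Y'_def)
    have T'_eq: "T' p = (\<Union>y\<in>Y'. fls_cball y R)"
    proof
      show "T' p \<subseteq> (\<Union>y\<in>Y'. fls_cball y R)"
      proof
        fix f assume f: "f \<in> T' p"
        then obtain y where y: "y \<in> Y" "f \<in> fls_cball y R"
          using Y(2) by (auto simp: T'_def)
        then have "y \<in> T' p"
          using invariant[OF f] by (simp add: fls_cball_commute)
        with y show "f \<in> (\<Union>y\<in>Y'. fls_cball y R)" by (auto simp: Y'_def)
      qed
    qed (auto simp: Y'_def intro: invariant)
    have "T \<subseteq> T' p" by (auto simp: T_def T'_def)
    then have T_eq: "T = (\<Union>y\<in>Y'. fls_cball y R - (\<Union>m\<in>{M..}. target m))"
      using T'_eq by (auto simp: T_def T'_def)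
    have "measure \<mu> T \<le> (\<Sum>y\<in>Y'. measure \<mu> (fls_cball y R - (\<Union>m\<in>{M..}. target m)))"
      unfolding T_eq
      by (intro measure_UNION_le Y'(1) sets.Diff fls_cball_sets sets.countable_UN') (auto intro: target_sets)
    also have "\<dots> \<le> (\<Sum>y\<in>Y'. (1 - \<delta>) * measure \<mu> (fls_cball y R))"
      by (intro sum_mono measure_avoid_le)
    also have "\<dots> = (1 - \<delta>) * (\<Sum>y\<in>Y'. measure \<mu> (fls_cball y R))"
      by (simp add: sum_distrib_left)
    also have "(\<Sum>y\<in>Y'. measure \<mu> (fls_cball y R)) = measure \<mu> (T' p)"
      unfolding T'_eq using Y' Y(3) fmeasurableD2[OF fls_cball_fmeasurable]
      by (intro measure_finite_Union[symmetric]) (auto intro: disjoint_family_on_mono)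
    finally show ?thesis .
  qed
  have "(\<lambda>p. measure \<mu> (T' p)) \<longlonglongrightarrow> measure \<mu> (\<Inter>p. T' p)"
  proof (rule Lim_measure_decseq)
    show "decseq T'" by (auto simp: decseq_def T'_def)
    show "emeasure \<mu> (T' p) \<noteq> \<infinity>" for p using T'_meas[of p] by (auto dest: fmeasurableD2)
  qed (use T'_sets in auto)
  also have "(\<Inter>p. T' p) = T"
    by (auto simp: T_def T'_def) (metis lessI atLeastLessThan_iff)
  finally have "(\<lambda>p. (1 - \<delta>) * measure \<mu> (T' p)) \<longlonglongrightarrow> (1 - \<delta>) * measure \<mu> T"
    by (intro tendsto_mult_left)
  \<comment> \<open>In the limit \<open>p \<rightarrow> \<infinity>\<close> the set is bounded by
    \<open>1 - \<delta>\<close> times its own finite measure, hence is null.\<close>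
  then have "measure \<mu> T \<le> (1 - \<delta>) * measure \<mu> T"
    using le by (intro LIMSEQ_le_const) auto
  then have "\<delta> * measure \<mu> T \<le> 0" by (simp add: algebra_simps)
  then have "measure \<mu> T = 0"
    using \<delta>_pos by (simp add: mult_le_0_iff measure_le_0_iff)
  then have "emeasure \<mu> T = 0"
    using fmeasurableD2[OF T_meas] by (simp add: emeasure_eq_ennreal_measure)
  then show ?thesis
    using T_sets unfolding T_def[symmetric] by (rule null_setsI)
qed

text \<open>A point in only finitely many targets avoids all targets from some \<open>M\<close> on,
  and countably many null sets contain all such points.\<close>

lemma AE_infinitely_many_targets: "AE f in \<mu>. \<exists>\<^sub>\<infinity>m. f \<in> target m"
proof (rule AE_I')
  show "(\<Union>j. \<Union>M. fls_cball 0 (- int j) - (\<Union>m\<in>{M..}. target m)) \<in> null_sets \<mu>"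
    by (intro null_sets_UN avoid_null)
  show "{f \<in> space \<mu>. \<not> (\<exists>\<^sub>\<infinity>m. f \<in> target m)} \<subseteq>
      (\<Union>j. \<Union>M. fls_cball 0 (- int j) - (\<Union>m\<in>{M..}. target m))"
    using UN_fls_cball by (fastforce simp: INFM_nat_le)
qed

end

section \<open>Slowly varying functions\<close>

text \<open>A distance up to \<open>d\<close> is covered by a fixed number \<open>n\<close> of steps
  of length at most \<open>B\<close>, each costing a factor \<open>a\<close>.\<close>

lemma slowly_varying_comparable:
  assumes "slowly_varying \<psi>" "d \<ge> 0"
  shows "\<exists>A\<ge>1. \<forall>x\<ge>0. \<forall>y\<ge>0. \<bar>x - y\<bar> \<le> d \<longrightarrow> \<psi> y \<le> A * \<psi> x"
proof -
  obtain B a where B: "B > 0" "a \<ge> 1"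
    and step: "\<And>x y. x \<ge> 0 \<Longrightarrow> y \<ge> 0 \<Longrightarrow> \<bar>x - y\<bar> \<le> B \<Longrightarrow> \<psi> y \<le> a * \<psi> x"
    using assms(1) unfolding slowly_varying_def by blast
  have iterate: "\<psi> y \<le> a ^ n * \<psi> x" if "x \<ge> 0" "y \<ge> 0" "\<bar>x - y\<bar> \<le> real n * B" for x y n
    using that
  proof (induction n arbitrary: y)
    case (Suc n)
    \<comment> \<open>One of \<open>n + 1\<close> equal steps from \<open>y\<close> towards
      \<open>x\<close>; as a convex combination it stays nonnegative.\<close>
    define w where "w = (x + real n * y) / (real n + 1)"
    have w: "w \<ge> 0" using Suc.prems by (simp add: w_def)
    have wy: "w - y = (x - y) / (real n + 1)" and xw: "x - w = real n * ((x - y) / (real n + 1))"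
      by (simp_all add: w_def field_simps)
    have le: "\<bar>(x - y) / (real n + 1)\<bar> \<le> B"
      using Suc.prems(3) by (simp add: abs_divide field_simps)
    have "\<bar>w - y\<bar> \<le> B" unfolding wy by (rule le)
    then have "\<psi> y \<le> a * \<psi> w"
      using step w Suc.prems by blast
    moreover have "\<bar>x - w\<bar> \<le> real n * B"
      unfolding xw abs_mult using le by (intro mult_mono) auto
    then have "\<psi> w \<le> a ^ n * \<psi> x"
      using Suc.IH w Suc.prems(1) by blast
    then have "a * \<psi> w \<le> a * (a ^ n * \<psi> x)"
      using B by (intro mult_left_mono) auto
    ultimately show ?case by simp
  qed simp
  obtain n where n: "d \<le> real n * B"
    using real_arch_simple[of "d / B"] B by (auto simp: field_simps)
  show ?thesis
  proof (intro exI[of _ "a ^ n"] conjI allI impI)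
    show "1 \<le> a ^ n" using B by simp
    fix x y :: real assume "0 \<le> x" "0 \<le> y" "\<bar>x - y\<bar> \<le> d"
    then show "\<psi> y \<le> a ^ n * \<psi> x"
      using iterate[of x y n] n by simp
  qed
qed

lemma nn_integral_powers_step:
  fixes q :: real
  assumes "q > 1" and "\<And>n. C n \<ge> 0"
  shows "(\<integral>\<^sup>+t. (\<Sum>n. ennreal (C n) * indicator {q ^ n..<q ^ Suc n} t) \<partial>lebesgue) =
    (\<Sum>n. ennreal (C n * (q ^ n * (q - 1))))"
proof -
  have "(\<integral>\<^sup>+t. ennreal (C n) * indicator {q ^ n..<q ^ Suc n} t \<partial>lebesgue) =
      ennreal (C n * (q ^ n * (q - 1)))" for n
  proof -
    have "q ^ n \<le> q ^ Suc n"
      using assms(1) by (intro power_increasing) auto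
    then have "emeasure lebesgue {q ^ n..<q ^ Suc n} = ennreal (q ^ n * (q - 1))"
      by (simp add: algebra_simps)
    then show ?thesis
      using assms by (simp add: nn_integral_cmult_indicator ennreal_mult)
  qed
  then show ?thesis
    by (subst nn_integral_suminf)
      (auto intro!: borel_measurable_times_ennreal borel_measurable_const borel_measurable_indicator)
qed

lemma powers_step_eq:
  fixes q t :: real
  assumes "q > 1" "q ^ n \<le> t" "t < q ^ Suc n"
  shows "(\<Sum>m. ennreal (C m) * indicator {q ^ m..<q ^ Suc m} t) = ennreal (C n)"
proof -
  have "m = n" if "q ^ m \<le> t" "t < q ^ Suc m" for m
  proof -
    have "q ^ m < q ^ Suc n" "q ^ n < q ^ Suc m" using that assms by linarith+
    then have "m < Suc n" "n < Suc m"
      using assms(1) power_less_imp_less_exp by blast+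
    then show ?thesis by simp
  qed
  then have "(\<Sum>m. ennreal (C m) * indicator {q ^ m..<q ^ Suc m} t) =
      (\<Sum>m\<in>{n}. ennreal (C m) * indicator {q ^ m..<q ^ Suc m} t)"
    by (intro suminf_finite) (auto simp: indicator_def)
  also have "\<dots> = ennreal (C n)"
    using assms by simp
  finally show ?thesis .
qed

lemma exists_power_interval:
  fixes q t :: real
  assumes "q > 1" "t \<ge> 1"
  shows "\<exists>n. q ^ n \<le> t \<and> t < q ^ Suc n"
proof -
  define m where "m = (LEAST m. t < q ^ m)"
  have "\<exists>m. t < q ^ m" using real_arch_pow[OF assms(1)] .
  then have m: "t < q ^ m" unfolding m_def by (rule LeastI_ex)
  then have "m \<noteq> 0" using assms(2) by (cases m) auto
  then obtain n where n: "m = Suc n" by (cases m) auto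
  then have "\<not> t < q ^ n" unfolding m_def by (metis lessI not_less_Least)
  with m n show ?thesis
    by (intro exI[of _ n]) auto
qed

text \<open>On \<open>[q^n, q^(n+1))\<close>, an interval of length \<open>q^n (q - 1)\<close>, the
  integrand is \<open>\<phi> (q^n) / q^n\<close> up to bounded factors. Step functions from both
  sides compare the integral with the series.\<close>

lemma nn_integral_iff_summable_powers:
  fixes \<phi> :: "real \<Rightarrow> real"
  assumes q: "q > 1" and A: "A \<ge> 1" and nonneg: "\<And>t. t \<ge> 1 \<Longrightarrow> \<phi> t \<ge> 0"
    and comp: "\<And>n t. q ^ n \<le> t \<Longrightarrow> t < q ^ Suc n \<Longrightarrow> \<phi> t \<le> A * \<phi> (q ^ n) \<and> \<phi> (q ^ n) \<le> A * \<phi> t"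
  shows "(\<integral>\<^sup>+t\<in>{1..}. ennreal (\<phi> t / t) \<partial>lebesgue) < \<infinity> \<longleftrightarrow> summable (\<lambda>n. \<phi> (q ^ n))"
    (is "?I < \<infinity> \<longleftrightarrow> _")
proof
  have ge: "\<phi> (q ^ n) \<ge> 0" for n
    using nonneg one_le_power[of q n] q by simp
  {
    assume fin: "?I < \<infinity>"
    \<comment> \<open>The smallest value that \<open>comp\<close> allows for \<open>\<phi>\<close>,
      divided by the upper end of the interval.\<close>
    define C where "C n = \<phi> (q ^ n) / (A * q ^ Suc n)" for n
    have C: "C n \<ge> 0" for n using ge A q by (simp add: C_def)
    have "(\<Sum>n. ennreal (C n * (q ^ n * (q - 1)))) =
        (\<integral>\<^sup>+t. (\<Sum>n. ennreal (C n) * indicator {q ^ n..<q ^ Suc n} t) \<partial>lebesgue)"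
      by (rule nn_integral_powers_step[symmetric]) (use q C in auto)
    also have "\<dots> \<le> ?I"
    proof (rule nn_integral_mono)
      fix t :: real
      show "(\<Sum>n. ennreal (C n) * indicator {q ^ n..<q ^ Suc n} t) \<le> ennreal (\<phi> t / t) * indicator {1..} t"
      proof (cases "t \<ge> 1")
        case True
        obtain n where n: "q ^ n \<le> t" "t < q ^ Suc n"
          using exists_power_interval[OF q True] by blast
        have "C n \<le> \<phi> t / t"
        proof -
          have "\<phi> (q ^ n) / A \<le> \<phi> t" using comp[OF n] A by (simp add: field_simps)
          then have "\<phi> (q ^ n) / A / q ^ Suc n \<le> \<phi> t / t"
            using n True nonneg[OF True] ge A by (intro frac_le) auto
          then show ?thesis by (simp add: C_def field_simps)
        qed
        then show ?thesis
          unfolding powers_step_eq[OF q n] using True by (simp add: ennreal_leI)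
      next
        case False
        have "q ^ n \<ge> 1" for n using q by simp
        then have "t \<notin> {q ^ n..<q ^ Suc n}" for n
          using False \<open>q ^ n \<ge> 1\<close> by (auto dest: order_trans)
        then show ?thesis by simp
      qed
    qed
    finally have "summable (\<lambda>n. C n * (q ^ n * (q - 1)))"
      using fin C q by (intro summable_suminf_not_top) auto
    then have "summable (\<lambda>n. (A * q / (q - 1)) * (C n * (q ^ n * (q - 1))))"
      by (rule summable_mult)
    also have "(\<lambda>n. (A * q / (q - 1)) * (C n * (q ^ n * (q - 1)))) = (\<lambda>n. \<phi> (q ^ n))"
    proof
      fix n
      have "A * q / u * (v / (A * (q * w)) * (w * u)) = v" if "u \<noteq> 0" "w \<noteq> 0" for u v w
        using q A that by simp
      from this[of "q - 1" "q ^ n"] show "A * q / (q - 1) * (C n * (q ^ n * (q - 1))) = \<phi> (q ^ n)"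
        using q by (simp add: C_def)
    qed
    finally show "summable (\<lambda>n. \<phi> (q ^ n))" .
  }
  {
    assume sum: "summable (\<lambda>n. \<phi> (q ^ n))"
    \<comment> \<open>The largest value that \<open>comp\<close> allows for \<open>\<phi>\<close>,
      divided by the lower end of the interval.\<close>
    define C where "C n = A * \<phi> (q ^ n) / q ^ n" for n
    have C: "C n \<ge> 0" for n using ge A q by (simp add: C_def)
    have "?I \<le> (\<integral>\<^sup>+t. (\<Sum>n. ennreal (C n) * indicator {q ^ n..<q ^ Suc n} t) \<partial>lebesgue)"
    proof (rule nn_integral_mono)
      fix t :: real
      show "ennreal (\<phi> t / t) * indicator {1..} t \<le> (\<Sum>n. ennreal (C n) * indicator {q ^ n..<q ^ Suc n} t)"
      proof (cases "t \<ge> 1")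
        case True
        obtain n where n: "q ^ n \<le> t" "t < q ^ Suc n"
          using exists_power_interval[OF q True] by blast
        have "\<phi> t / t \<le> C n"
          unfolding C_def using comp[OF n] nonneg[OF True] n q by (intro frac_le) auto
        then show ?thesis
          unfolding powers_step_eq[OF q n] using True by (simp add: ennreal_leI)
      qed simp
    qed
    also have "\<dots> = (\<Sum>n. ennreal (C n * (q ^ n * (q - 1))))"
      by (rule nn_integral_powers_step) (use q C in auto)
    also have "\<dots> = (\<Sum>n. ennreal (A * (q - 1) * \<phi> (q ^ n)))"
      using q by (intro arg_cong[of _ _ suminf] ext arg_cong[of _ _ ennreal]) (simp add: C_def)
    also have "\<dots> < \<infinity>"
      unfolding infinity_ennreal_def less_top[symmetric]
      using summable_mult[OF sum] by (rule ennreal_suminf_neq_top) (use ge A q in simp)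
    finally show "?I < \<infinity>" .
  }
qed

section \<open>Approximation by the orbit of infinity\<close>

lemma finite_degree_le: "finite {Q :: 'a::{comm_ring_1,finite} poly. degree Q \<le> n}"
proof (rule finite_subset)
  show "{Q :: 'a poly. degree Q \<le> n} \<subseteq> (\<lambda>c. \<Sum>i\<le>n. monom (c i) i) ` PiE {..n} (\<lambda>_. UNIV)"
  proof
    fix Q :: "'a poly" assume "Q \<in> {Q. degree Q \<le> n}"
    then have "Q = (\<Sum>i\<le>n. monom (restrict (coeff Q) {..n} i) i)"
      by (intro poly_eqI) (auto simp: coeff_sum_monom intro!: coeff_eq_0)
    then show "Q \<in> (\<lambda>c. \<Sum>i\<le>n. monom (c i) i) ` PiE {..n} (\<lambda>_. UNIV)"
      by (rule image_eqI[where x = "restrict (coeff Q) {..n}"]) simp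
  qed
qed (intro finite_imageI finite_PiE, auto)

lemma abs_infty_poly_to_fls_inv:
  "Q \<noteq> 0 \<Longrightarrow> abs_infty (poly_to_fls_inv (Q :: 'a::{field,finite} poly)) = real CARD('a) ^ degree Q"
  by (simp add: abs_infty_def)

lemma approximants_iff:
  fixes f :: "'a::{field,finite} fls"
  shows "(P, Q) \<in> approximants \<Gamma> \<phi> f \<longleftrightarrow>
    Q \<noteq> 0 \<and> coprime P Q \<and> poly_to_fls_inv P / poly_to_fls_inv Q \<in> orbit_fractions \<Gamma> (degree Q) \<and>
    abs_infty (f - poly_to_fls_inv P / poly_to_fls_inv Q)
      \<le> \<phi> (real CARD('a) ^ degree Q) / (real CARD('a) ^ degree Q)\<^sup>2"
proof -
  have "poly_to_fls_inv P / poly_to_fls_inv Q \<in> reduced_fractions (degree Q)" if "Q \<noteq> 0" "coprime P Q"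
    using that by (auto simp: reduced_fractions_def)
  then show ?thesis
    by (auto simp: approximants_def orbit_fractions_def abs_infty_poly_to_fls_inv)
qed

lemma approximant_in_ball:
  fixes f :: "'a::{field,finite} fls"
  assumes "(P, Q) \<in> approximants \<Gamma> \<phi> f"
    and "\<phi> (real CARD('a) ^ degree Q) \<le> real CARD('a) powi (- k)"
  shows "f \<in> fls_cball (poly_to_fls_inv P / poly_to_fls_inv Q) (2 * int (degree Q) + k)"
proof -
  let ?q = "real CARD('a)"
  have "abs_infty (f - poly_to_fls_inv P / poly_to_fls_inv Q) \<le> ?q powi (- k) / (?q ^ degree Q)\<^sup>2"
    using assms by (auto simp: approximants_iff intro: order_trans[OF _ divide_right_mono])
  also have "\<dots> = ?q powi (- (2 * int (degree Q) + k))"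
    by (simp add: power_int_diff power_int_minus power_int_mult power2_eq_square field_simps power_mult
        flip: power_mult_distrib)
  finally show ?thesis
    by (simp add: mem_fls_cball_iff_abs_infty)
qed

text \<open>Eventual avoidance bounds \<open>degree Q\<close>. Then \<open>P / Q\<close> is one of
  finitely many reduced fractions near \<open>f\<close> and \<open>Q\<close> one of finitely many
  polynomials, and together they determine \<open>P\<close>.\<close>

lemma finite_approximants:
  fixes f :: "'a::{field,finite} fls"
  assumes \<mu>: "haar_measure (\<mu> :: 'a fls measure)"
    and k: "\<And>m. \<phi> (real CARD('a) ^ m) \<le> real CARD('a) powi (- k m)"
    and ev: "\<forall>\<^sub>F m in sequentially. f \<notin> (\<Union>x\<in>reduced_fractions m. fls_cball x (2 * int m + k m))"
  shows "finite (approximants \<Gamma> \<phi> f)"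
proof -
  interpret fls_haar \<mu> by standard (rule \<mu>)
  obtain m0 where m0: "\<And>m. m \<ge> m0 \<Longrightarrow> f \<notin> (\<Union>x\<in>reduced_fractions m. fls_cball x (2 * int m + k m))"
    using ev by (auto simp: eventually_sequentially)
  define S where "S = (\<Union>m<m0. reduced_fractions m \<inter> fls_cball f (2 * int m + k m))"
  have "finite (S \<times> {Q :: 'a poly. degree Q \<le> m0})"
    unfolding S_def by (intro finite_cartesian_product finite_UN_I finite_reduced_fractions_in_ball finite_degree_le) auto
  moreover have "(\<lambda>(P, Q). (poly_to_fls_inv P / poly_to_fls_inv Q, Q)) ` approximants \<Gamma> \<phi> f
      \<subseteq> S \<times> {Q. degree Q \<le> m0}"
  proof (rule image_subsetI)
    fix z assume "z \<in> approximants \<Gamma> \<phi> f"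
    then obtain P Q where z: "z = (P, Q)" and PQ: "(P, Q) \<in> approximants \<Gamma> \<phi> f"
      by (cases z) auto
    let ?x = "poly_to_fls_inv P / poly_to_fls_inv Q"
    have x: "?x \<in> reduced_fractions (degree Q)"
      using PQ by (auto simp: approximants_iff orbit_fractions_def)
    have f: "f \<in> fls_cball ?x (2 * int (degree Q) + k (degree Q))"
      using PQ k by (rule approximant_in_ball)
    with x m0[of "degree Q"] have "degree Q < m0" by (meson UN_I linorder_not_le)
    with x f show "(case z of (P, Q) \<Rightarrow> (poly_to_fls_inv P / poly_to_fls_inv Q, Q)) \<in> S \<times> {Q. degree Q \<le> m0}"
      by (auto simp: z S_def fls_cball_commute)
  qed
  moreover have "inj_on (\<lambda>(P, Q). (poly_to_fls_inv P / poly_to_fls_inv Q, Q)) (approximants \<Gamma> \<phi> f)"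
    by (auto simp: inj_on_def approximants_iff poly_to_fls_inv_eq_iff)
  ultimately show ?thesis
    by (meson inj_on_finite)
qed

text \<open>Each target hit yields a couple whose denominator has that degree, so infinitely many
  degrees occur.\<close>

lemma infinite_approximants:
  fixes f :: "'a::{field,finite} fls"
  assumes k: "\<And>m. real CARD('a) powi (- k m) \<le> \<phi> (real CARD('a) ^ m)"
    and inf: "\<exists>\<^sub>\<infinity>m. f \<in> (\<Union>x\<in>orbit_fractions \<Gamma> m. fls_cball x (2 * int m + k m))"
  shows "infinite (approximants \<Gamma> \<phi> f)"
proof
  let ?q = "real CARD('a)"
  assume "finite (approximants \<Gamma> \<phi> f)"
  then have "finite ((\<lambda>(P, Q). degree Q) ` approximants \<Gamma> \<phi> f)" by simp
  moreover have "{m. f \<in> (\<Union>x\<in>orbit_fractions \<Gamma> m. fls_cball x (2 * int m + k m))}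
      \<subseteq> (\<lambda>(P, Q). degree Q) ` approximants \<Gamma> \<phi> f"
  proof
    fix m assume "m \<in> {m. f \<in> (\<Union>x\<in>orbit_fractions \<Gamma> m. fls_cball x (2 * int m + k m))}"
    then obtain x where x: "x \<in> orbit_fractions \<Gamma> m" "f \<in> fls_cball x (2 * int m + k m)" by blast
    then obtain P Q where PQ: "x = poly_to_fls_inv P / poly_to_fls_inv Q" "Q \<noteq> 0" "coprime P Q"
      "degree Q = m" by (auto simp: orbit_fractions_def reduced_fractions_def)
    have "abs_infty (f - x) \<le> ?q powi (- (2 * int m + k m))"
      using x(2) by (simp add: mem_fls_cball_iff_abs_infty)
    also have "\<dots> = ?q powi (- k m) / (?q ^ m)\<^sup>2"
      by (simp add: power_int_diff power_int_minus power_int_mult power2_eq_square field_simps power_mult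
          flip: power_mult_distrib)
    also have "\<dots> \<le> \<phi> (?q ^ m) / (?q ^ m)\<^sup>2"
      by (intro divide_right_mono k) simp
    finally have "(P, Q) \<in> approximants \<Gamma> \<phi> f"
      using x PQ by (simp add: approximants_iff)
    then show "m \<in> (\<lambda>(P, Q). degree Q) ` approximants \<Gamma> \<phi> f"
      using PQ(4) by force
  qed
  ultimately show False
    using inf by (simp add: INFM_iff_infinite finite_subset)
qed

theorem corollary2p3:
  fixes \<mu> :: "'a::{field,finite} fls measure"
    and \<Gamma> :: "('a poly ^ 2 ^ 2) set"
    and \<phi> :: "real \<Rightarrow> real"
  assumes "haar_measure \<mu>"
    and "subgroup \<Gamma> SL2"
    and "finite (rcosets\<^bsub>SL2\<^esub> \<Gamma>)"
    and "\<And>t. t \<ge> 0 \<Longrightarrow> \<phi> t \<ge> 0"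
    and "slowly_varying (\<lambda>u. \<phi> (exp u))"
  shows "((\<integral>\<^sup>+t\<in>{1..}. ennreal (\<phi> t / t) \<partial>lebesgue) = \<infinity> \<longrightarrow>
            (AE f in \<mu>. infinite (approximants \<Gamma> \<phi> f))) \<and>
         ((\<integral>\<^sup>+t\<in>{1..}. ennreal (\<phi> t / t) \<partial>lebesgue) < \<infinity> \<longrightarrow>
            (AE f in \<mu>. \<not> infinite (approximants \<Gamma> \<phi> f)))"
proof -
  interpret fls_haar \<mu> by standard (rule assms(1))
  have q_pow_ge_1: "q ^ n \<ge> 1" for n
    by (intro one_le_power less_imp_le q_bounds(2))
  define s where "s n = \<phi> (q ^ n)" for n
  have s_nonneg: "s n \<ge> 0" for n
    using assms(4) q_bounds(1) by (simp add: s_def)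
  \<comment> \<open>Slow variation of \<open>\<phi> (exp u)\<close> read multiplicatively:
    \<open>\<phi>\<close> is comparable at points of bounded ratio.\<close>
  have comp: "\<exists>A\<ge>1. \<forall>t\<ge>1. \<forall>u\<ge>1. \<bar>ln t - ln u\<bar> \<le> d \<longrightarrow> \<phi> u \<le> A * \<phi> t" if d: "d \<ge> 0" for d
  proof -
    obtain A where A: "A \<ge> 1"
      "\<And>x y. x \<ge> 0 \<Longrightarrow> y \<ge> 0 \<Longrightarrow> \<bar>x - y\<bar> \<le> d \<Longrightarrow> \<phi> (exp y) \<le> A * \<phi> (exp x)"
      using slowly_varying_comparable[OF assms(5) d] by blast
    have "\<phi> u \<le> A * \<phi> t" if "t \<ge> 1" "u \<ge> 1" "\<bar>ln t - ln u\<bar> \<le> d" for t u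
      using A(2)[of "ln t" "ln u"] that by simp
    with A(1) show ?thesis by blast
  qed
  have ln_q: "ln q \<ge> 0" by (rule ln_ge_zero) simp
  have s_comp: "\<exists>A\<ge>1. \<forall>m n. m \<le> n + D \<and> n \<le> m + D \<longrightarrow> s m \<le> A * s n" for D
  proof -
    obtain A where A: "A \<ge> 1"
      "\<And>t u. t \<ge> 1 \<Longrightarrow> u \<ge> 1 \<Longrightarrow> \<bar>ln t - ln u\<bar> \<le> real D * ln q \<Longrightarrow> \<phi> u \<le> A * \<phi> t"
      using comp[OF mult_nonneg_nonneg[OF of_nat_0_le_iff ln_q]] by blast
    have "s m \<le> A * s n" if "m \<le> n + D" "n \<le> m + D" for m n
      unfolding s_def
    proof (intro A(2) q_pow_ge_1)
      have "ln (q ^ n) - ln (q ^ m) = (real n - real m) * ln q"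
        by (simp add: ln_realpow algebra_simps)
      moreover have "\<bar>real n - real m\<bar> \<le> real D" using that by linarith
      ultimately show "\<bar>ln (q ^ n) - ln (q ^ m)\<bar> \<le> real D * ln q"
        by (simp add: abs_mult mult_right_mono)
    qed
    with A(1) show ?thesis by blast
  qed
  have integral: "(\<integral>\<^sup>+t\<in>{1..}. ennreal (\<phi> t / t) \<partial>lebesgue) < \<infinity> \<longleftrightarrow> summable s"
  proof -
    obtain A where A: "A \<ge> 1"
      "\<And>t u. t \<ge> 1 \<Longrightarrow> u \<ge> 1 \<Longrightarrow> \<bar>ln t - ln u\<bar> \<le> ln q \<Longrightarrow> \<phi> u \<le> A * \<phi> t"
      using comp[OF ln_q] by blast
    show ?thesis
      unfolding s_def
    proof (rule nn_integral_iff_summable_powers[OF q_bounds(2) A(1)])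
      show "\<phi> t \<ge> 0" if "t \<ge> 1" for t using that assms(4) by simp
      fix n t assume t: "q ^ n \<le> t" "t < q ^ Suc n"
      have "t \<ge> 1" using t q_pow_ge_1[of n] by linarith
      have "ln (q ^ n) \<le> ln t" "ln t \<le> ln (q ^ Suc n)"
        using t \<open>t \<ge> 1\<close> q_pow_ge_1[of n] by (intro ln_mono; linarith)+
      then have "\<bar>ln t - ln (q ^ n)\<bar> \<le> ln q" "\<bar>ln (q ^ n) - ln t\<bar> \<le> ln q"
        by (auto simp: ln_realpow ln_mult algebra_simps)
      then show "\<phi> t \<le> A * \<phi> (q ^ n) \<and> \<phi> (q ^ n) \<le> A * \<phi> t"
        using A(2) \<open>t \<ge> 1\<close> q_pow_ge_1[of n] by blast
    qed
  qed
  show ?thesis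
  proof (intro conjI impI)
    assume "(\<integral>\<^sup>+t\<in>{1..}. ennreal (\<phi> t / t) \<partial>lebesgue) = \<infinity>"
    then have div: "\<not> summable s" using integral by auto
    \<comment> \<open>By comparability one zero would make all of \<open>s\<close> vanish, against
      divergence.\<close>
    have s_pos: "s n > 0" for n
    proof (rule ccontr)
      assume "\<not> s n > 0"
      then have 0: "s n = 0" using s_nonneg[of n] by simp
      have s_0: "s m = 0" for m
      proof -
        obtain A where "\<And>i j. i \<le> j + (m + n) \<and> j \<le> i + (m + n) \<longrightarrow> s i \<le> A * s j"
          using s_comp by blast
        from this[of m n] show ?thesis using 0 s_nonneg[of m] by simp
      qed
      have "s = (\<lambda>_. 0)"
        by (rule ext) (rule s_0)
      then have "summable s"
        by (simp only: summable_zero)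
      with div show False ..
    qed
    \<comment> \<open>Rounding up costs at most a factor \<open>q\<close>. Truncation at 1 and
      division by \<open>q^2\<close> therefore keep the rounded value at most
      \<open>min 1 (s n) / q\<close>, which gives both \<open>k n \<ge> 1\<close> and a radius
      allowed by \<open>\<phi>\<close>.\<close>
    define t where "t n = min 1 (s n) / q\<^sup>2" for n
    have t_pos: "t n > 0" for n using s_pos by (simp add: t_def)
    obtain k where k: "\<And>n. t n \<le> q powi (- k n)" "\<And>n. q powi (- k n) \<le> q * t n"
      using choice[of "\<lambda>n k. t n \<le> q powi (- k) \<and> q powi (- k) \<le> q * t n"]
        exists_powi_between[OF t_pos] by blast
    have qt: "q * t n = min 1 (s n) / q" for n
      by (simp add: t_def power2_eq_square)
    have k_le: "q powi (- k n) \<le> \<phi> (q ^ n)" for n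
    proof -
      have "min 1 (s n) / q \<le> min 1 (s n) / 1"
        using s_pos[of n] q_ge_2 by (intro divide_left_mono) auto
      then show ?thesis
        using k(2)[of n] by (simp add: qt s_def)
    qed
    have k_ge_1: "k n \<ge> 1" for n
    proof (rule ccontr)
      assume "\<not> k n \<ge> 1"
      then have "q powi 0 \<le> q powi (- k n)"
        by (intro q_powi_mono) simp
      then have "1 \<le> q powi (- k n)"
        by (simp only: power_int_0_right)
      also have "\<dots> \<le> min 1 (s n) / q" using k(2)[of n] by (simp add: qt)
      also have "\<dots> \<le> 1 / q" by (intro divide_right_mono) (auto simp: less_imp_le)
      also have "\<dots> < 1" using q_ge_2 by simp
      finally show False by simp
    qed
    obtain \<eta> L where \<eta>: "\<eta> > 0" and window: "\<And>x0 r. \<exists>n0. \<forall>n\<ge>n0. \<exists>m\<in>{n..n + L}.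
      \<eta> * q powi (- r) \<le> real (card (orbit_fractions \<Gamma> m \<inter> fls_cball x0 r)) * q powi (- 2 * int m)"
      using orbit_fractions_window[OF assms(2,3)] by blast
    obtain A where A: "A \<ge> 1" "\<And>m n. m \<le> n + L \<Longrightarrow> n \<le> m + L \<Longrightarrow> s m \<le> A * s n"
      using s_comp[of L] by blast
    interpret fls_targets \<mu> "orbit_fractions \<Gamma>" k \<eta> "A * q" L
    proof
      show "orbit_fractions \<Gamma> m \<subseteq> reduced_fractions m" for m
        by (auto simp: orbit_fractions_def)
      show "q powi (- k n) \<le> A * q * q powi (- k (n + d))" if "d \<le> L" for n d
      proof -
        have "s n \<le> A * s (n + d)" using A(2) that by simp
        then have "min 1 (s n) \<le> A * min 1 (s (n + d))"
          using A(1) by (simp add: min_def)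
        then have "t n \<le> A * t (n + d)"
          by (simp add: t_def divide_right_mono)
        have "q powi (- k n) \<le> q * t n" by (rule k(2))
        also have "\<dots> \<le> q * (A * t (n + d))"
          using \<open>t n \<le> A * t (n + d)\<close> by (intro mult_left_mono) (auto simp: less_imp_le)
        also have "\<dots> = A * q * t (n + d)" by simp
        also have "\<dots> \<le> A * q * q powi (- k (n + d))"
          using A(1) by (intro mult_left_mono k(1)) (auto simp: less_imp_le)
        finally show ?thesis .
      qed
      show "\<not> summable (\<lambda>n. q powi (- k n))"
      proof
        assume "summable (\<lambda>n. q powi (- k n))"
        then have "summable t"
          by (rule summable_comparison_test'[of _ 0]) (use k(1) t_pos in \<open>simp add: less_imp_le\<close>)
        then have "summable (\<lambda>n. q\<^sup>2 * t n)" by (rule summable_mult)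
        then have sum: "summable (\<lambda>n. min 1 (s n))" by (simp add: t_def)
        \<comment> \<open>Truncation does not spoil divergence: a summable truncated sequence tends
          to 0, so it eventually coincides with \<open>s\<close>.\<close>
        then have "\<forall>\<^sub>F n in sequentially. min 1 (s n) < 1"
          by (intro order_tendstoD[OF summable_LIMSEQ_zero]) auto
        then have "\<forall>\<^sub>F n in sequentially. norm (s n) \<le> min 1 (s n)"
          by eventually_elim (use s_nonneg in \<open>auto simp: min_def split: if_splits\<close>)
        then have "summable s" using sum by (rule summable_comparison_test_ev)
        with div show False ..
      qed
    qed (rule k_ge_1 \<eta> window)+
    show "AE f in \<mu>. infinite (approximants \<Gamma> \<phi> f)"
      using AE_infinitely_many_targets
    proof (rule AE_mp, intro AE_I2 impI)
      fix f assume "\<exists>\<^sub>\<infinity>m. f \<in> target m"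
      then show "infinite (approximants \<Gamma> \<phi> f)"
        unfolding target_def using k_le by (intro infinite_approximants[of k]) (auto simp: q_def)
    qed
  next
    assume "(\<integral>\<^sup>+t\<in>{1..}. ennreal (\<phi> t / t) \<partial>lebesgue) < \<infinity>"
    then have "summable s" using integral by simp
    \<comment> \<open>The geometric term makes \<open>t\<close> positive, so that it can be rounded
      even where \<open>s\<close> vanishes, and keeps it summable.\<close>
    define t where "t n = s n + (1 / 2) ^ n" for n
    have t_pos: "t n > 0" for n using s_nonneg[of n] by (simp add: t_def add_nonneg_pos)
    have "summable t"
      unfolding t_def using \<open>summable s\<close> by (intro summable_add summable_geometric) auto
    obtain k where k: "\<And>n. t n \<le> q powi (- k n)" "\<And>n. q powi (- k n) \<le> q * t n"
      using choice[of "\<lambda>n k. t n \<le> q powi (- k) \<and> q powi (- k) \<le> q * t n"]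
        exists_powi_between[OF t_pos] by blast
    have "summable (\<lambda>n. q powi (- k n))"
      using k(2) by (intro summable_comparison_test'[OF summable_mult[OF \<open>summable t\<close>, of q], of 0]) auto
    then have "AE f in \<mu>. \<forall>\<^sub>F m in sequentially.
        f \<notin> (\<Union>x\<in>reduced_fractions m. fls_cball x (2 * int m + k m))"
      by (rule AE_finitely_many_close_fractions)
    then show "AE f in \<mu>. \<not> infinite (approximants \<Gamma> \<phi> f)"
    proof (rule AE_mp, intro AE_I2 impI)
      fix f :: "'a fls" assume f: "\<forall>\<^sub>F m in sequentially. f \<notin> (\<Union>x\<in>reduced_fractions m. fls_cball x (2 * int m + k m))"
      have "\<phi> (q ^ m) \<le> q powi (- k m)" for m
        using k(1)[of m] zero_le_power[of "1 / 2 :: real" m] unfolding t_def s_def by linarith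
      then have "finite (approximants \<Gamma> \<phi> f)"
        using finite_approximants[OF assms(1) _ f] by (simp add: q_def)
      then show "\<not> infinite (approximants \<Gamma> \<phi> f)" by simp
    qed
  qed
qed

end
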